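(* Let $M$ be an oriented real analytic manifold of dimension $n$, $X$ its (oriented) complexification, $p_0=(x_0;\sqrt{-1}\xi_0)$ a point of $T^*_MX=\sqrt{-1}T^*M$, and let $u$ be a hyperfunction at $x_0$ (i.e. defined near $x_0$). Work under a ($C^1$-class) local trivialization $(M,X)\simeq(\mathbb{R}^n_x,\mathbb{C}^n=\mathbb{R}^n_x\times\sqrt{-1}\mathbb{R}^n_y)$ near $x_0$. Then $u$ is microlocally analytic at $p_0$ if and only if there exist a closed cone $G\subset\mathbb{R}^n_y$ satisfying $$G\setminus\{0\}\subset\{y\in\mathbb{R}^n\mid\operatorname{Re}\langle\sqrt{-1}y,\sqrt{-1}\xi_0\rangle>0\}=\{y\in\mathbb{R}^n\mid\langle y,\xi_0\rangle<0\},$$ an open neighborhood $V$ of $x_0$ in $X$ and a representative $(\tau_1,\tau_{01})\in\mathscr{E}^{(0,n)}(V)\oplus\mathscr{E}^{(0,n-1)}(V\setminus M)$ of $u$ near $x_0$ which satisfies $\tau_1=0$ and $\operatorname{Supp}_{V\setminus M}(\tau_{01})\subset\mathbb{R}^n_x\times\sqrt{-1}G$.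
   Context: $\mathscr{E}^{(p,q)}$ denotes $C^\infty$ $(p,q)$-forms and $\mathscr{O}$ the sheaf of holomorphic functions on $X$. For an open set $V$ in a complex manifold and a closed set $S$, $H^{0,q}_{\bar\vartheta}(V,V\setminus S)$ is the $q$-th cohomology of the complex $\mathscr{E}^{(0,q)}(V)\oplus\mathscr{E}^{(0,q-1)}(V\setminus S)$ with differential $\bar\vartheta(\xi_1,\xi_{01})=(\bar\partial\xi_1,\xi_1-\bar\partial\xi_{01})$; it is canonically isomorphic to $H^q_{S\cap V}(V;\mathscr{O})$. Orientations being fixed, orientation sheaves are omitted and the stalk of the sheaf $\mathscr{B}$ of hyperfunctions at $x_0$ is $\mathscr{B}_{x_0}\simeq\varinjlim_{V}H^{0,n}_{\bar\vartheta}(V,V\setminus M)$, $V$ running over open neighborhoods of $x_0$ in $X$. A representative of $u$ near $x_0$ is a cocycle in $\mathscr{E}^{(0,n)}(V)\oplus\mathscr{E}^{(0,n-1)}(V\setminus M)$ whose class has germ $u$ at $x_0$. Subsets of $X$ near $x_0$ and the covector $\xi_0$ are expressed through the local trivialization. The stalk at $p_0$ of the sheaf $\mathscr{C}$ of microfunctions on $T^*_MX$ is $$\mathscr{C}_{p_0}=\varinjlim_{V,G}H^n_{\mathbb{R}^n_x\times\sqrt{-1}G}(V;\mathscr{O})\simeq\varinjlim_{V,G}H^{0,n}_{\bar\vartheta}(V,V\setminus(\mathbb{R}^n_x\times\sqrt{-1}G)),$$ where $V$ runs through open neighborhoods of $x_0$ and $G$ through closed cones in $\mathbb{R}^n_y$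 with $G\setminus\{0\}\subset\{y\mid\langle y,\xi_0\rangle<0\}$. The spectral map $\operatorname{sp}:\mathscr{B}_{x_0}\to\mathscr{C}_{p_0}$ is induced by restricting the second component of cocycles from $V\setminus M$ to $V\setminus(\mathbb{R}^n_x\times\sqrt{-1}G)$. The hyperfunction $u$ is microlocally analytic at $p_0$ if $\operatorname{sp}(u)$ is zero at $p_0$, i.e. in $\mathscr{C}_{p_0}$. *)

theory Defs
  imports "HOL-Analysis.Analysis" "HOL-Library.Function_Algebras"
begin

section \<open>Differentiability on open subsets of normed spaces\<close>

text \<open>For finite-dimensional domains and open \<open>S\<close> this is real \<open>C\<^sup>k\<close>: all iterated directional
  derivatives up to order \<open>k\<close> exist and are continuous.\<close>

primrec Ck_on :: "nat \<Rightarrow> 'a::real_normed_vector set \<Rightarrow> ('a \<Rightarrow> 'b::real_normed_vector) \<Rightarrow> bool" where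
  "Ck_on 0 S f \<longleftrightarrow> continuous_on S f"
| "Ck_on (Suc k) S f \<longleftrightarrow>
     (\<forall>x\<in>S. f differentiable (at x)) \<and> (\<forall>v. Ck_on k S (\<lambda>x. frechet_derivative f (at x) v))"

definition smooth_on :: "'a::real_normed_vector set \<Rightarrow> ('a \<Rightarrow> 'b::real_normed_vector) \<Rightarrow> bool" where
  "smooth_on S f \<longleftrightarrow> (\<forall>k. Ck_on k S f)"

text \<open>Smoothness is automatic for maps with complex linear derivative; it is included as in the
  definition of holomorphic maps as smooth solutions of the Cauchy--Riemann equations.\<close>

definition holo_map_on :: "(complex^'n) set \<Rightarrow> (complex^'n \<Rightarrow> complex^'n) \<Rightarrow> bool" where
  "holo_map_on S f \<longleftrightarrow> smooth_on S f \<and>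
     (\<forall>z\<in>S. \<forall>a v. frechet_derivative f (at z) (a *s v) = a *s frechet_derivative f (at z) v)"

text \<open>The derivative of \<open>f\<close> at \<open>z\<close> in direction \<open>v\<close>, projected to its conjugate linear part
  (as a function of \<open>v\<close>).\<close>

definition dbar_dir :: "(complex^'n \<Rightarrow> complex) \<Rightarrow> complex^'n \<Rightarrow> complex^'n \<Rightarrow> complex" where
  "dbar_dir f z v =
     (frechet_derivative f (at z) v + \<i> * frechet_derivative f (at z) (\<i> *s v)) / 2"

section \<open>The coordinate space\<close>

definition real_subspace :: "(complex^'n) set" where
  "real_subspace = {z. \<forall>i. Im (z $ i) = 0}"

definition im_vec :: "complex^'n \<Rightarrow> real^'n" where
  "im_vec z = (\<chi> i. Im (z $ i))"

definition i_vec :: "real^'n \<Rightarrow> complex^'n" where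
  "i_vec y = (\<chi> i. \<i> * complex_of_real (y $ i))"

definition bilin :: "complex^'n \<Rightarrow> complex^'n \<Rightarrow> complex" where
  "bilin z w = (\<Sum>i\<in>UNIV. z $ i * w $ i)"

section \<open>Complex manifolds and complexifications\<close>

text \<open>The manifold is the whole type \<open>'a\<close>; a chart is a pair of its domain and its coordinate map.\<close>

type_synonym ('a, 'n) chart = "'a set \<times> ('a \<Rightarrow> complex^'n)"

definition chart_inv :: "('a, 'n) chart \<Rightarrow> complex^'n \<Rightarrow> 'a" where
  "chart_inv c = inv_into (fst c) (snd c)"

definition transition :: "('a, 'n) chart \<Rightarrow> ('a, 'n) chart \<Rightarrow> complex^'n \<Rightarrow> complex^'n" where
  "transition c d = snd d \<circ> chart_inv c"

definition transition_deriv ::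
  "('a, 'n) chart \<Rightarrow> ('a, 'n) chart \<Rightarrow> 'a \<Rightarrow> complex^'n \<Rightarrow> complex^'n" where
  "transition_deriv c d x = frechet_derivative (transition c d) (at (snd c x))"

definition complex_atlas :: "('a::topological_space, 'n::finite) chart set \<Rightarrow> bool" where
  "complex_atlas A \<longleftrightarrow>
     (\<Union>c\<in>A. fst c) = UNIV \<and>
     (\<forall>c\<in>A. open (fst c) \<and> open (snd c ` fst c) \<and>
        homeomorphism (fst c) (snd c ` fst c) (snd c) (chart_inv c)) \<and>
     (\<forall>c\<in>A. \<forall>d\<in>A. holo_map_on (snd c ` (fst c \<inter> fst d)) (transition c d))"

text \<open>The closed subset \<open>M\<close> of the complex manifold with atlas \<open>A\<close> is locally \<open>\<real>\<^sup>n\<close> in \<open>\<complex>\<^sup>n\<close>: the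
  holomorphic charts in \<open>B\<close> flatten \<open>M\<close>. Their restrictions to \<open>M\<close> have real analytic transitions
  (restrictions of holomorphic maps), hence form a real analytic atlas of \<open>M\<close>; it is oriented by
  positivity of the Jacobians. At points of \<open>M\<close> the complex Jacobian matrix of a transition is the
  real Jacobian matrix of its restriction to \<open>\<real>\<^sup>n\<close>.\<close>

definition oriented_complexification ::
  "('a::topological_space, 'n::finite) chart set \<Rightarrow> ('a, 'n) chart set \<Rightarrow> 'a set \<Rightarrow> bool" where
  "oriented_complexification A B M \<longleftrightarrow>
     complex_atlas A \<and> complex_atlas (A \<union> B) \<and> closed M \<and> M \<subseteq> (\<Union>b\<in>B. fst b) \<and>
     (\<forall>b\<in>B. snd b ` (fst b \<inter> M) = snd b ` fst b \<inter> real_subspace) \<and>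
     (\<forall>b\<in>B. \<forall>d\<in>B. \<forall>x\<in>M \<inter> fst b \<inter> fst d. 0 < Re (det (matrix (transition_deriv b d x))))"

text \<open>\<open>\<Phi>\<close> is a \<open>C\<^sup>1\<close> diffeomorphism of pairs from \<open>(M \<inter> W, W)\<close> onto \<open>(\<real>\<^sup>n \<inter> \<Phi> ` W, \<Phi> ` W)\<close>;
  it need not be holomorphic.\<close>

definition C1_trivialization ::
  "('a::topological_space, 'n::finite) chart set \<Rightarrow> 'a set \<Rightarrow> 'a \<Rightarrow> 'a set
     \<Rightarrow> ('a \<Rightarrow> complex^'n) \<Rightarrow> bool" where
  "C1_trivialization A M x0 W \<Phi> \<longleftrightarrow>
     open W \<and> x0 \<in> W \<and> open (\<Phi> ` W) \<and>
     homeomorphism W (\<Phi> ` W) \<Phi> (inv_into W \<Phi>) \<and>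
     \<Phi> ` (W \<inter> M) = \<Phi> ` W \<inter> real_subspace \<and>
     (\<forall>c\<in>A. Ck_on 1 (snd c ` (W \<inter> fst c)) (\<Phi> \<circ> chart_inv c) \<and>
        Ck_on 1 (\<Phi> ` (W \<inter> fst c)) (snd c \<circ> inv_into W \<Phi>))"

text \<open>A point of the fibre of \<open>T\<^sup>*\<^sub>M X\<close> at \<open>x0\<close>: a real covector, given by its expressions in the
  charts around \<open>x0\<close>, that vanishes on the vectors tangent to \<open>M\<close>.\<close>

definition conormal_covector ::
  "('a::topological_space, 'n::finite) chart set \<Rightarrow> ('a, 'n) chart set \<Rightarrow> 'a set \<Rightarrow> 'a
     \<Rightarrow> (('a, 'n) chart \<Rightarrow> complex^'n \<Rightarrow> real) \<Rightarrow> bool" where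
  "conormal_covector A B M x0 p \<longleftrightarrow>
     x0 \<in> M \<and>
     (\<forall>c\<in>A. x0 \<in> fst c \<longrightarrow> linear (p c)) \<and>
     (\<forall>c\<in>A. \<forall>d\<in>A. \<forall>v. x0 \<in> fst c \<inter> fst d \<longrightarrow> p c v = p d (transition_deriv c d x0 v)) \<and>
     (\<forall>b\<in>B. \<forall>c\<in>A. \<forall>v\<in>real_subspace.
        x0 \<in> fst b \<inter> fst c \<longrightarrow> p c (transition_deriv b c x0 v) = 0)"

text \<open>In the trivialization the conormal covector \<open>p\<close> is \<open>\<surd>-1 \<xi>0\<close>, whose value on a vector with
  imaginary part \<open>y\<close> is \<open>Re \<langle>\<surd>-1 y, \<surd>-1 \<xi>0\<rangle>\<close>.\<close>

definition trivialized_covector ::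
  "('a::topological_space, 'n::finite) chart set \<Rightarrow> ('a \<Rightarrow> complex^'n) \<Rightarrow> 'a
     \<Rightarrow> (('a, 'n) chart \<Rightarrow> complex^'n \<Rightarrow> real) \<Rightarrow> real^'n \<Rightarrow> bool" where
  "trivialized_covector A \<Phi> x0 p \<xi>0 \<longleftrightarrow>
     (\<forall>c\<in>A. \<forall>v. x0 \<in> fst c \<longrightarrow>
        p c v = Re (bilin
          (i_vec (im_vec (frechet_derivative (\<Phi> \<circ> chart_inv c) (at (snd c x0)) v)))
          (i_vec \<xi>0)))"

section \<open>Forms of type \<open>(0,q)\<close>\<close>

text \<open>Conjugate linear alternating \<open>q\<close>-forms on \<open>\<complex>\<^sup>n\<close>, extended by zero to lists of other lengths.
  The degree is an integer so that the degrees \<open>-1\<close> and \<open>-2\<close> occurring in the relative Dolbeault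
  complex need no separate treatment: then only the zero form remains.\<close>

definition conj_alt :: "int \<Rightarrow> ((complex^'n) list \<Rightarrow> complex) \<Rightarrow> bool" where
  "conj_alt q \<alpha> \<longleftrightarrow>
     (\<forall>vs. int (length vs) \<noteq> q \<longrightarrow> \<alpha> vs = 0) \<and>
     (\<forall>vs i a v w. i < length vs \<longrightarrow>
        \<alpha> (vs[i := a *s v + w]) = cnj a * \<alpha> (vs[i := v]) + \<alpha> (vs[i := w])) \<and>
     (\<forall>vs i j. i < j \<and> j < length vs \<and> vs ! i = vs ! j \<longrightarrow> \<alpha> vs = 0)"

text \<open>A tangent vector at \<open>x\<close> is represented by its coordinates in each chart around \<open>x\<close>;
  accordingly \<open>\<omega> x c vs\<close> is the value at \<open>x\<close> on the tangent vectors with coordinates \<open>vs\<close>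
  in the chart \<open>c\<close>.\<close>

type_synonym ('a, 'n) form = "'a \<Rightarrow> ('a, 'n) chart \<Rightarrow> (complex^'n) list \<Rightarrow> complex"

text \<open>The space of \<open>C\<^sup>\<infinity>\<close> \<open>(0,q)\<close>-forms on the open set \<open>V\<close>. Forms are extended by zero outside \<open>V\<close> and
  outside the charts, so that equality of forms is equality of functions.\<close>

definition forms ::
  "('a::topological_space, 'n::finite) chart set \<Rightarrow> int \<Rightarrow> 'a set \<Rightarrow> ('a, 'n) form set" where
  "forms A q V = {\<omega>.
     (\<forall>x c. \<not> (c \<in> A \<and> x \<in> V \<inter> fst c) \<longrightarrow> \<omega> x c = 0) \<and>
     (\<forall>c\<in>A. \<forall>x\<in>V \<inter> fst c. conj_alt q (\<omega> x c)) \<and>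
     (\<forall>c\<in>A. \<forall>vs. smooth_on (snd c ` (V \<inter> fst c)) (\<lambda>z. \<omega> (chart_inv c z) c vs)) \<and>
     (\<forall>c\<in>A. \<forall>d\<in>A. \<forall>x\<in>V \<inter> fst c \<inter> fst d. \<forall>vs.
        \<omega> x c vs = \<omega> x d (map (transition_deriv c d x) vs))}"

definition form_restrict :: "'a set \<Rightarrow> ('a, 'n) form \<Rightarrow> ('a, 'n) form" where
  "form_restrict V \<omega> = (\<lambda>x. if x \<in> V then \<omega> x else 0)"

definition form_support :: "'a::topological_space set \<Rightarrow> ('a, 'n) form \<Rightarrow> 'a set" where
  "form_support V \<omega> = V \<inter> closure {x \<in> V. \<omega> x \<noteq> 0}"

text \<open>The invariant formula \<open>(dbar \<omega>)(v\<^sub>0,\<dots>,v\<^sub>q) = \<Sum>\<^sub>i (-1)\<^sup>i dbar\<^sub>v\<^sub>i \<omega>(v\<^sub>0,\<dots>,v\<^sub>i omitted,\<dots>,v\<^sub>q)\<close>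
  for constant vector fields in a chart.\<close>

definition dbar ::
  "('a, 'n::finite) chart set \<Rightarrow> 'a set \<Rightarrow> ('a, 'n) form \<Rightarrow> ('a, 'n) form" where
  "dbar A V \<omega> = (\<lambda>x c vs.
     if c \<in> A \<and> x \<in> V \<inter> fst c
     then \<Sum>i<length vs. (- 1) ^ i *
       dbar_dir (\<lambda>z. \<omega> (chart_inv c z) c (take i vs @ drop (Suc i) vs)) (snd c x) (vs ! i)
     else 0)"

section \<open>Relative Dolbeault cohomology\<close>

text \<open>A pair \<open>(V, S)\<close> stands for the pair \<open>(V, V - S)\<close> in \<open>H\<^sup>0\<^sup>,\<^sup>q(V, V - S)\<close>; it is used with \<open>V\<close> and
  \<open>V - S\<close> open.\<close>

type_synonym 'a pair = "'a set \<times> 'a set"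
type_synonym ('a, 'n) cochain = "('a, 'n) form \<times> ('a, 'n) form"

definition cochains ::
  "('a::topological_space, 'n::finite) chart set \<Rightarrow> int \<Rightarrow> 'a pair \<Rightarrow> ('a, 'n) cochain set" where
  "cochains A q = (\<lambda>(V, S). forms A q V \<times> forms A (q - 1) (V - S))"

definition vartheta ::
  "('a::topological_space, 'n::finite) chart set \<Rightarrow> 'a pair \<Rightarrow> ('a, 'n) cochain \<Rightarrow> ('a, 'n) cochain"
  where
  "vartheta A = (\<lambda>(V, S) (\<tau>1, \<tau>01).
     (dbar A V \<tau>1, form_restrict (V - S) \<tau>1 - dbar A (V - S) \<tau>01))"

definition cocycles ::
  "('a::topological_space, 'n::finite) chart set \<Rightarrow> int \<Rightarrow> 'a pair \<Rightarrow> ('a, 'n) cochain set" where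
  "cocycles A q P = {\<tau> \<in> cochains A q P. vartheta A P \<tau> = (0, 0)}"

definition coboundaries ::
  "('a::topological_space, 'n::finite) chart set \<Rightarrow> int \<Rightarrow> 'a pair \<Rightarrow> ('a, 'n) cochain set" where
  "coboundaries A q P = vartheta A P ` cochains A (q - 1) P"

definition cohomologous ::
  "('a::topological_space, 'n::finite) chart set \<Rightarrow> int \<Rightarrow> 'a pair
     \<Rightarrow> (('a, 'n) cochain \<times> ('a, 'n) cochain) set" where
  "cohomologous A q P = {(\<sigma>, \<tau>). \<sigma> \<in> cocycles A q P \<and> \<tau> \<in> cocycles A q P \<and>
     \<sigma> - \<tau> \<in> coboundaries A q P}"

definition cohom_class ::
  "('a::topological_space, 'n::finite) chart set \<Rightarrow> int \<Rightarrow> 'a pair \<Rightarrow> ('a, 'n) cochain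
     \<Rightarrow> ('a, 'n) cochain set" where
  "cohom_class A q P \<tau> = cohomologous A q P `` {\<tau>}"

definition cohomology ::
  "('a::topological_space, 'n::finite) chart set \<Rightarrow> int \<Rightarrow> 'a pair \<Rightarrow> ('a, 'n) cochain set set" where
  "cohomology A q P = cocycles A q P // cohomologous A q P"

text \<open>\<open>finer P Q\<close> says that restricting cochains from \<open>P\<close> to \<open>Q\<close> makes sense:
  for \<open>P = (V, S)\<close> and \<open>Q = (V', S')\<close> we have \<open>V' \<subseteq> V\<close> and \<open>V' - S' \<subseteq> V - S\<close>.\<close>

definition finer :: "'a pair \<Rightarrow> 'a pair \<Rightarrow> bool" where
  "finer = (\<lambda>(V, S) (V', S'). V' \<subseteq> V \<and> V' \<inter> S \<subseteq> S')"

definition cochain_restrict :: "'a pair \<Rightarrow> ('a, 'n) cochain \<Rightarrow> ('a, 'n) cochain" where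
  "cochain_restrict = (\<lambda>(V, S) (\<tau>1, \<tau>01). (form_restrict V \<tau>1, form_restrict (V - S) \<tau>01))"

definition cohom_restrict ::
  "('a::topological_space, 'n::finite) chart set \<Rightarrow> int \<Rightarrow> 'a pair
     \<Rightarrow> ('a, 'n) cochain set \<Rightarrow> ('a, 'n) cochain set" where
  "cohom_restrict A q Q h = (\<Union>\<tau>\<in>h. cohom_class A q Q (cochain_restrict Q \<tau>))"

section \<open>Direct limits of relative Dolbeault cohomology\<close>

text \<open>Elements of the direct limit over a family \<open>I\<close> of pairs, directed by \<open>finer\<close>, are
  equivalence classes of pairs \<open>(P, h)\<close> with \<open>P \<in> I\<close> and \<open>h\<close> a cohomology class on \<open>P\<close>.\<close>

type_synonym ('a, 'n) germ = "('a pair \<times> ('a, 'n) cochain set) set"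

definition limit_rel ::
  "('a::topological_space, 'n::finite) chart set \<Rightarrow> int \<Rightarrow> 'a pair set
     \<Rightarrow> (('a pair \<times> ('a, 'n) cochain set) \<times> ('a pair \<times> ('a, 'n) cochain set)) set" where
  "limit_rel A q I = {((P, h), (Q, k)).
     P \<in> I \<and> Q \<in> I \<and> h \<in> cohomology A q P \<and> k \<in> cohomology A q Q \<and>
     (\<exists>R\<in>I. finer P R \<and> finer Q R \<and> cohom_restrict A q R h = cohom_restrict A q R k)}"

definition dir_limit ::
  "('a::topological_space, 'n::finite) chart set \<Rightarrow> int \<Rightarrow> 'a pair set \<Rightarrow> ('a, 'n) germ set" where
  "dir_limit A q I = (SIGMA P:I. cohomology A q P) // limit_rel A q I"

definition dir_limit_zero ::
  "('a::topological_space, 'n::finite) chart set \<Rightarrow> int \<Rightarrow> 'a pair set \<Rightarrow> ('a, 'n) germ" where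
  "dir_limit_zero A q I = (\<Union>P\<in>I. limit_rel A q I `` {(P, cohom_class A q P (0, 0))})"

text \<open>The map of direct limits over \<open>I\<close> and \<open>J\<close> induced by restriction. As usual for maps on
  quotients, it is the union of the classes obtained from all choices of representatives, which are
  all equal.\<close>

definition dir_limit_map ::
  "('a::topological_space, 'n::finite) chart set \<Rightarrow> int \<Rightarrow> 'a pair set \<Rightarrow> ('a, 'n) germ
     \<Rightarrow> ('a, 'n) germ" where
  "dir_limit_map A q J u =
     (\<Union>(P, h)\<in>u. \<Union>Q\<in>{Q\<in>J. finer P Q}. limit_rel A q J `` {(Q, cohom_restrict A q Q h)})"

section \<open>Hyperfunctions and microfunctions at a point\<close>

definition hyperfunction_pairs :: "'a::topological_space set \<Rightarrow> 'a \<Rightarrow> 'a pair set" where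
  "hyperfunction_pairs M x0 = {(V, M) | V. open V \<and> x0 \<in> V}"

definition hyperfunction_stalk ::
  "('a::topological_space, 'n::finite) chart set \<Rightarrow> 'a set \<Rightarrow> 'a \<Rightarrow> ('a, 'n) germ set" where
  "hyperfunction_stalk A M x0 = dir_limit A (int CARD('n)) (hyperfunction_pairs M x0)"

text \<open>A representative of \<open>u\<close> on \<open>V\<close>: a cocycle on \<open>(V, V - M)\<close> whose class has germ \<open>u\<close>.\<close>

definition represents ::
  "('a::topological_space, 'n::finite) chart set \<Rightarrow> 'a set \<Rightarrow> 'a set \<Rightarrow> ('a, 'n) cochain
     \<Rightarrow> ('a, 'n) germ \<Rightarrow> bool" where
  "represents A M V \<tau> u \<longleftrightarrow>
     \<tau> \<in> cocycles A (int CARD('n)) (V, M) \<and>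
     ((V, M), cohom_class A (int CARD('n)) (V, M) \<tau>) \<in> u"

text \<open>Cones contain the origin; \<open>cone\<close> alone would admit the empty set.\<close>

definition closed_cone :: "(real^'n) set \<Rightarrow> bool" where
  "closed_cone G \<longleftrightarrow> closed G \<and> cone G \<and> 0 \<in> G"

text \<open>\<open>\<real>\<^sup>n\<^sub>x \<times> \<surd>-1 G\<close>, transported by the trivialization.\<close>

definition tube :: "'a set \<Rightarrow> ('a \<Rightarrow> complex^'n) \<Rightarrow> (real^'n) set \<Rightarrow> 'a set" where
  "tube W \<Phi> G = {x \<in> W. im_vec (\<Phi> x) \<in> G}"

definition microfunction_pairs ::
  "'a::topological_space set \<Rightarrow> ('a \<Rightarrow> complex^'n::finite) \<Rightarrow> 'a \<Rightarrow> real^'n \<Rightarrow> 'a pair set" where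
  "microfunction_pairs W \<Phi> x0 \<xi>0 = {(V, tube W \<Phi> G) | V G.
     open V \<and> x0 \<in> V \<and> V \<subseteq> W \<and> closed_cone G \<and> G - {0} \<subseteq> {y. y \<bullet> \<xi>0 < 0}}"

definition microfunction_stalk ::
  "('a::topological_space, 'n::finite) chart set \<Rightarrow> 'a set \<Rightarrow> ('a \<Rightarrow> complex^'n) \<Rightarrow> 'a
     \<Rightarrow> real^'n \<Rightarrow> ('a, 'n) germ set" where
  "microfunction_stalk A W \<Phi> x0 \<xi>0 = dir_limit A (int CARD('n)) (microfunction_pairs W \<Phi> x0 \<xi>0)"

text \<open>The spectral map from \<open>hyperfunction_stalk A M x0\<close> to \<open>microfunction_stalk A W \<Phi> x0 \<xi>0\<close>.\<close>

definition spectral_map ::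
  "('a::topological_space, 'n::finite) chart set \<Rightarrow> 'a set \<Rightarrow> ('a \<Rightarrow> complex^'n) \<Rightarrow> 'a
     \<Rightarrow> real^'n \<Rightarrow> ('a, 'n) germ \<Rightarrow> ('a, 'n) germ" where
  "spectral_map A W \<Phi> x0 \<xi>0 = dir_limit_map A (int CARD('n)) (microfunction_pairs W \<Phi> x0 \<xi>0)"

definition microlocally_analytic ::
  "('a::topological_space, 'n::finite) chart set \<Rightarrow> 'a set \<Rightarrow> ('a \<Rightarrow> complex^'n) \<Rightarrow> 'a
     \<Rightarrow> real^'n \<Rightarrow> ('a, 'n) germ \<Rightarrow> bool" where
  "microlocally_analytic A W \<Phi> x0 \<xi>0 u \<longleftrightarrow>
     spectral_map A W \<Phi> x0 \<xi>0 u =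
       dir_limit_zero A (int CARD('n)) (microfunction_pairs W \<Phi> x0 \<xi>0)"

end

(* If sp(u) = 0, then a representative sigma of u becomes a coboundary theta(rho1, rho01) on some
   (V, V - (R^n x iG)), where V may be taken inside one chart. Since G is a closed cone in the open
   half space (together with 0), it has a slightly larger closed cone G' around it of the same kind.
   Multiply rho01 by a smooth function h on V - M that vanishes near R^n x iG and is 1 outside
   R^n x iG'; then h rho01 lives on V - M, and sigma - theta(rho1, h rho01) represents u, has first
   component 0 and is zero outside R^n x iG'. The trivialization is only C^1, so h cannot be pulled
   back from R^n; it comes from smooth separation of closed sets in the chart. The converse holds
   because such a representative restricts to 0 on (V, V - (R^n x iG)). *)

theory Submission
  imports Defs "HOL-Computational_Algebra.Polynomial"
begin

text \<open>The cut-off depends on directions in y and in general takes both values 0 and 1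
  arbitrarily close to M. It is therefore asked for on V - M only, which suffices because it
  multiplies the second component alone. The room for it comes from compactness: on the unit vectors
  of G the pairing with \<xi>0 is at most some -d < 0, and between the cones y.\<xi>0 <= -d|y| and
  y.\<xi>0 <= -(d/3)|y| the function may pass from 0 to 1. A second obstacle is that h rho01 must
  have an image under theta that is again a cochain, while the fact that dbar preserves forms on a
  manifold rests on second derivatives of the transition maps. They are avoided: dbar rho01 is a
  difference of forms by the equation that exhibits sigma as a coboundary, and the Leibniz rule
  transfers this to h rho01. Finally, classes and germs are sets, and maps between them are unions
  over all representatives. The converse therefore has to treat every representative of u, not only
  the given one, and uses refinements common to both directed families.\<close>

section \<open>Calculus of \<open>C\<^sup>k\<close> maps\<close>

text \<open>On an open set a derivative depends on nearby values only, so the directional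
  derivatives of f and g agree on S too and the induction applies to them. This is how functions
  extended by zero outside S are handled.\<close>

lemma Ck_on_cong_imp:
  assumes "open S" "\<And>x. x \<in> S \<Longrightarrow> f x = g x" "Ck_on k S f"
  shows "Ck_on k S g"
  using assms(2,3)
proof (induction k arbitrary: f g)
  case 0
  then show ?case by (simp cong: continuous_on_cong)
next
  case (Suc k)
  have der: "(g has_derivative frechet_derivative f (at x)) (at x)" if "x \<in> S" for x
    using Suc.prems that \<open>open S\<close>
    by (metis Ck_on.simps(2) frechet_derivative_works has_derivative_transform_within_open)
  then have "frechet_derivative f (at x) v = frechet_derivative g (at x) v" if "x \<in> S" for x v
    using that by (metis frechet_derivative_at)
  then have "Ck_on k S (\<lambda>x. frechet_derivative g (at x) v)" for v
    using Suc.IH[of "\<lambda>x. frechet_derivative f (at x) v" "\<lambda>x. frechet_derivative g (at x) v"]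
      Suc.prems(2) by simp
  then show ?case using der by (auto simp: differentiable_def)
qed

lemma Ck_on_cong:
  assumes "open S" "\<And>x. x \<in> S \<Longrightarrow> f x = g x"
  shows "Ck_on k S f \<longleftrightarrow> Ck_on k S g"
  using Ck_on_cong_imp[of S f g] Ck_on_cong_imp[of S g f] assms by metis

text \<open>\<open>frechet_derivative\<close> is a choice operator; uniqueness of derivatives lets
  an explicit formula \<open>f'\<close> replace it. The inductions for linear images, sums,
  products, compositions and inverses run through this rule.\<close>

lemma Ck_on_SucI:
  assumes "open S" "\<And>x. x \<in> S \<Longrightarrow> (f has_derivative f' x) (at x)"
    and "\<And>v. Ck_on k S (\<lambda>x. f' x v)"
  shows "Ck_on (Suc k) S f"
proof -
  have "Ck_on k S (\<lambda>x. frechet_derivative f (at x) v)" for v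
    using Ck_on_cong_imp[OF assms(1) _ assms(3)[of v], of "\<lambda>x. frechet_derivative f (at x) v"]
      frechet_derivative_at[OF assms(2)] by metis
  then show ?thesis using assms(2) by (auto simp: differentiable_def)
qed

lemma Ck_on_SucD: "Ck_on (Suc k) S f \<Longrightarrow> Ck_on k S f"
proof (induction k arbitrary: f)
  case 0
  then show ?case
    by (auto intro!: continuous_at_imp_continuous_on differentiable_imp_continuous_within)
next
  case (Suc k)
  from Suc.prems show ?case
    unfolding Ck_on.simps(2)[of "Suc k"] Ck_on.simps(2)[of k] using Suc.IH by auto
qed

lemma Ck_on_subset: "Ck_on k S f \<Longrightarrow> T \<subseteq> S \<Longrightarrow> Ck_on k T f"
  by (induction k arbitrary: f) (auto intro: continuous_on_subset)

text \<open>In \<open>Ck_on\<close> derivatives are taken at points of the full space rather than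
  within the set, so the derivatives on different T are values of one and the same function and the
  induction passes to it directly.\<close>

lemma Ck_on_local:
  assumes "\<And>x. x \<in> S \<Longrightarrow> \<exists>T. open T \<and> x \<in> T \<and> Ck_on k T f"
  shows "Ck_on k S f"
  using assms
proof (induction k arbitrary: f)
  case 0
  have "isCont f x" if "x \<in> S" for x
    using 0[OF that] by (auto simp: continuous_on_eq_continuous_at)
  then show ?case by (simp add: continuous_at_imp_continuous_on)
next
  case (Suc k)
  have "f differentiable at x" if "x \<in> S" for x
    using Suc.prems[OF that] by auto
  moreover have "Ck_on k S (\<lambda>x. frechet_derivative f (at x) v)" for v
    by (rule Suc.IH) (use Suc.prems in force)
  ultimately show ?case by simp
qed

section \<open>Closure properties of the class C^k\<close>

lemma Ck_on_const: "Ck_on k S (\<lambda>x. c)"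
  by (induction k arbitrary: c) auto

lemma Ck_on_id: "Ck_on k S (\<lambda>x. x)"
  by (cases k) (auto simp: Ck_on_const)

lemma Ck_on_bounded_linear:
  assumes "open S" "bounded_linear L" "Ck_on k S f"
  shows "Ck_on k S (\<lambda>x. L (f x))"
  using assms(3)
proof (induction k arbitrary: f)
  case 0
  then show ?case using bounded_linear.continuous_on[OF assms(2)] by auto
next
  case (Suc k)
  show ?case
  proof (rule Ck_on_SucI[OF assms(1)])
    fix x assume "x \<in> S"
    then have "(f has_derivative frechet_derivative f (at x)) (at x)"
      using Suc.prems by (auto simp: frechet_derivative_works)
    then show "((\<lambda>x. L (f x)) has_derivative (\<lambda>v. L (frechet_derivative f (at x) v))) (at x)"
      using bounded_linear.has_derivative[OF assms(2)] by blast
  next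
    show "Ck_on k S (\<lambda>x. L (frechet_derivative f (at x) v))" for v
      using Suc by simp
  qed
qed

lemma Ck_on_add:
  assumes "open S" "Ck_on k S f" "Ck_on k S g"
  shows "Ck_on k S (\<lambda>x. f x + g x)"
  using assms(2,3)
proof (induction k arbitrary: f g)
  case 0
  then show ?case by (auto intro: continuous_on_add)
next
  case (Suc k)
  show ?case
  proof (rule Ck_on_SucI[OF assms(1)])
    fix x assume "x \<in> S"
    then show "((\<lambda>x. f x + g x) has_derivative
        (\<lambda>v. frechet_derivative f (at x) v + frechet_derivative g (at x) v)) (at x)"
      using Suc.prems by (intro has_derivative_add) (auto simp: frechet_derivative_works)
  next
    show "Ck_on k S (\<lambda>x. frechet_derivative f (at x) v + frechet_derivative g (at x) v)" for v
      using Suc by simp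
  qed
qed

lemma Ck_on_bilinear:
  assumes "open S" "bounded_bilinear B" "Ck_on k S f" "Ck_on k S g"
  shows "Ck_on k S (\<lambda>x. B (f x) (g x))"
  using assms(3,4)
proof (induction k arbitrary: f g)
  case 0
  then show ?case using bounded_bilinear.continuous_on[OF assms(2)] by auto
next
  case (Suc k)
  show ?case
  proof (rule Ck_on_SucI[OF assms(1)])
    fix x assume "x \<in> S"
    then have "(f has_derivative frechet_derivative f (at x)) (at x)"
      "(g has_derivative frechet_derivative g (at x)) (at x)"
      using Suc.prems by (auto simp: frechet_derivative_works)
    then show "((\<lambda>x. B (f x) (g x)) has_derivative
        (\<lambda>v. B (f x) (frechet_derivative g (at x) v) + B (frechet_derivative f (at x) v) (g x))) (at x)"
      using bounded_bilinear.FDERIV[OF assms(2)] by blast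
  next
    show "Ck_on k S (\<lambda>x. B (f x) (frechet_derivative g (at x) v)
        + B (frechet_derivative f (at x) v) (g x))" for v
    proof (rule Ck_on_add[OF assms(1)])
      \<comment> \<open>The product rule leaves one factor undifferentiated; it enters with order k
        only.\<close>
      have "Ck_on k S f" "Ck_on k S g" using Suc.prems Ck_on_SucD by blast+
      then show "Ck_on k S (\<lambda>x. B (f x) (frechet_derivative g (at x) v))"
        "Ck_on k S (\<lambda>x. B (frechet_derivative f (at x) v) (g x))"
        using Suc.prems by (auto intro: Suc.IH)
    qed
  qed
qed

lemma Ck_on_sum:
  assumes "open S" "\<And>i. i \<in> I \<Longrightarrow> Ck_on k S (f i)"
  shows "Ck_on k S (\<lambda>x. \<Sum>i\<in>I. f i x)"
  using assms(2)
  by (induction I rule: infinite_finite_induct) (auto simp: Ck_on_const intro!: Ck_on_add assms(1))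

text \<open>In the chain rule f'(g x)(g' x v) the direction fed to f' varies with x, whereas
  \<open>Ck_on\<close> for f speaks about fixed directions. Expanding g' x v in a basis turns it
  into fixed directions b with scalar coefficients; hence the Euclidean codomain of g.\<close>

lemma Ck_on_compose:
  fixes g :: "'a::real_normed_vector \<Rightarrow> 'b::euclidean_space"
  assumes "open S" "Ck_on k S g" "Ck_on k T f" "g ` S \<subseteq> T"
  shows "Ck_on k S (\<lambda>x. f (g x))"
  using assms(2,3)
proof (induction k arbitrary: f)
  case 0
  then show ?case using continuous_on_compose2[OF _ _ assms(4)] by auto
next
  case (Suc k)
  let ?f' = "\<lambda>y. frechet_derivative f (at y)" and ?g' = "\<lambda>x. frechet_derivative g (at x)"
  show ?case
  proof (rule Ck_on_SucI[OF assms(1)])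
    fix x assume x: "x \<in> S"
    then have gx: "g x \<in> T" using assms(4) by auto
    have g: "(g has_derivative ?g' x) (at x)" and f: "(f has_derivative ?f' (g x)) (at (g x))"
      using Suc.prems x gx by (auto simp: frechet_derivative_works)
    have lin: "linear (?f' (g x))" using f by (rule has_derivative_linear)
    have "?f' (g x) (?g' x v) = (\<Sum>b\<in>Basis. (?g' x v \<bullet> b) *\<^sub>R ?f' (g x) b)" for v
      using lin
      by (subst euclidean_representation[of "?g' x v", symmetric]) (simp add: linear_sum linear_scale)
    then show "((\<lambda>x. f (g x)) has_derivative (\<lambda>v. \<Sum>b\<in>Basis. (?g' x v \<bullet> b) *\<^sub>R ?f' (g x) b)) (at x)"
      using has_derivative_compose[OF g f] by simp
  next
    fix v
    have g: "Ck_on k S g" using Suc.prems Ck_on_SucD by blast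
    have "Ck_on k S (\<lambda>x. ?f' (g x) b)" for b
      using Suc.IH[OF g, of "\<lambda>y. ?f' y b"] Suc.prems(2) by simp
    moreover have "Ck_on k S (\<lambda>x. ?g' x v \<bullet> b)" for b
      using Ck_on_bounded_linear[OF assms(1) bounded_linear_inner_left, of k "\<lambda>x. ?g' x v"]
        Suc.prems(1) by simp
    ultimately show "Ck_on k S (\<lambda>x. \<Sum>b\<in>Basis. (?g' x v \<bullet> b) *\<^sub>R ?f' (g x) b)"
      by (intro Ck_on_sum assms(1) Ck_on_bilinear[OF assms(1) bounded_bilinear_scaleR])
  qed
qed

text \<open>The derivative -(1/f) f' (1/f) contains 1/f again, but only to order k, where the
  induction hypothesis for the same f supplies it.\<close>

lemma Ck_on_inverse:
  fixes f :: "'a::real_normed_vector \<Rightarrow> real"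
  assumes "open S" "Ck_on k S f" "\<And>x. x \<in> S \<Longrightarrow> f x \<noteq> 0"
  shows "Ck_on k S (\<lambda>x. inverse (f x))"
  using assms(2)
proof (induction k)
  case 0
  then show ?case using assms(3) by (auto intro: continuous_on_inverse)
next
  case (Suc k)
  show ?case
  proof (rule Ck_on_SucI[OF assms(1)])
    fix x assume x: "x \<in> S"
    then have "(f has_derivative frechet_derivative f (at x)) (at x)"
      using Suc.prems by (auto simp: frechet_derivative_works)
    then show "((\<lambda>x. inverse (f x)) has_derivative
       (\<lambda>v. - (inverse (f x) * frechet_derivative f (at x) v * inverse (f x)))) (at x)"
      using x assms(3) by (auto intro: has_derivative_inverse)
  next
    fix v
    have "Ck_on k S (\<lambda>x. inverse (f x))" using Suc Ck_on_SucD by blast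
    moreover have "Ck_on k S (\<lambda>x. frechet_derivative f (at x) v)" using Suc.prems by simp
    ultimately show "Ck_on k S (\<lambda>x. - (inverse (f x) * frechet_derivative f (at x) v * inverse (f x)))"
      by (intro Ck_on_bounded_linear[OF assms(1) bounded_linear_minus[OF bounded_linear_ident]]
          Ck_on_bilinear[OF assms(1) bounded_bilinear_mult])
  qed
qed

section \<open>The same rules for smooth maps\<close>

lemma smooth_on_cong:
  assumes "open S" "\<And>x. x \<in> S \<Longrightarrow> f x = g x"
  shows "smooth_on S f \<longleftrightarrow> smooth_on S g"
  unfolding smooth_on_def using Ck_on_cong[OF assms] by simp

lemma smooth_on_cong_imp:
  assumes "open S" "smooth_on S f" "\<And>x. x \<in> S \<Longrightarrow> g x = f x"
  shows "smooth_on S g"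
  using assms(2) smooth_on_cong[OF assms(1,3)] by simp

lemma smooth_on_subset: "smooth_on S f \<Longrightarrow> T \<subseteq> S \<Longrightarrow> smooth_on T f"
  unfolding smooth_on_def using Ck_on_subset by blast

lemma smooth_on_local:
  assumes "\<And>x. x \<in> S \<Longrightarrow> \<exists>T. open T \<and> x \<in> T \<and> smooth_on T f"
  shows "smooth_on S f"
  unfolding smooth_on_def
proof
  show "Ck_on k S f" for k
    by (rule Ck_on_local) (use assms in \<open>unfold smooth_on_def, blast\<close>)
qed

lemma smooth_on_const: "smooth_on S (\<lambda>x. c)"
  by (simp add: smooth_on_def Ck_on_const)

lemma smooth_on_id: "smooth_on S (\<lambda>x. x)"
  by (simp add: smooth_on_def Ck_on_id)

lemma smooth_on_bounded_linear:
  "open S \<Longrightarrow> bounded_linear L \<Longrightarrow> smooth_on S f \<Longrightarrow> smooth_on S (\<lambda>x. L (f x))"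
  by (simp add: smooth_on_def Ck_on_bounded_linear)

lemma smooth_on_add:
  "open S \<Longrightarrow> smooth_on S f \<Longrightarrow> smooth_on S g \<Longrightarrow> smooth_on S (\<lambda>x. f x + g x)"
  by (simp add: smooth_on_def Ck_on_add)

lemma smooth_on_minus: "open S \<Longrightarrow> smooth_on S f \<Longrightarrow> smooth_on S (\<lambda>x. - f x)"
  by (rule smooth_on_bounded_linear[OF _ bounded_linear_minus[OF bounded_linear_ident]])

lemma smooth_on_diff:
  "open S \<Longrightarrow> smooth_on S f \<Longrightarrow> smooth_on S g \<Longrightarrow> smooth_on S (\<lambda>x. f x - g x)"
  using smooth_on_add[OF _ _ smooth_on_minus, of S f g] by simp

lemma smooth_on_bilinear:
  "open S \<Longrightarrow> bounded_bilinear B \<Longrightarrow> smooth_on S f \<Longrightarrow> smooth_on S g \<Longrightarrow> smooth_on S (\<lambda>x. B (f x) (g x))"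
  by (simp add: smooth_on_def Ck_on_bilinear)

lemma smooth_on_mult:
  fixes f g :: "'a::real_normed_vector \<Rightarrow> 'b::real_normed_algebra"
  shows "open S \<Longrightarrow> smooth_on S f \<Longrightarrow> smooth_on S g \<Longrightarrow> smooth_on S (\<lambda>x. f x * g x)"
  by (rule smooth_on_bilinear[OF _ bounded_bilinear_mult])

lemma smooth_on_sum:
  "open S \<Longrightarrow> (\<And>i. i \<in> I \<Longrightarrow> smooth_on S (f i)) \<Longrightarrow> smooth_on S (\<lambda>x. \<Sum>i\<in>I. f i x)"
  by (simp add: smooth_on_def Ck_on_sum)

lemma smooth_on_prod:
  fixes f :: "'i \<Rightarrow> 'a::real_normed_vector \<Rightarrow> 'b::{real_normed_algebra,comm_ring_1}"
  assumes "open S" "\<And>i. i \<in> I \<Longrightarrow> smooth_on S (f i)"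
  shows "smooth_on S (\<lambda>x. \<Prod>i\<in>I. f i x)"
  using assms(2)
  by (induction I rule: infinite_finite_induct) (auto simp: smooth_on_const intro!: smooth_on_mult assms(1))

lemma smooth_on_compose:
  fixes g :: "'a::real_normed_vector \<Rightarrow> 'b::euclidean_space"
  shows "open S \<Longrightarrow> smooth_on S g \<Longrightarrow> smooth_on T f \<Longrightarrow> g ` S \<subseteq> T \<Longrightarrow> smooth_on S (\<lambda>x. f (g x))"
  unfolding smooth_on_def using Ck_on_compose by blast

lemma smooth_on_inverse:
  fixes f :: "'a::real_normed_vector \<Rightarrow> real"
  shows "open S \<Longrightarrow> smooth_on S f \<Longrightarrow> (\<And>x. x \<in> S \<Longrightarrow> f x \<noteq> 0) \<Longrightarrow> smooth_on S (\<lambda>x. inverse (f x))"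
  by (simp add: smooth_on_def Ck_on_inverse)

lemma smooth_on_directional:
  "smooth_on S f \<Longrightarrow> smooth_on S (\<lambda>x. frechet_derivative f (at x) v)"
  by (metis Ck_on.simps(2) smooth_on_def)

lemma smooth_on_has_derivative:
  assumes "smooth_on S f" "x \<in> S"
  shows "(f has_derivative frechet_derivative f (at x)) (at x)"
proof -
  have "Ck_on (Suc 0) S f" using assms(1) by (simp only: smooth_on_def)
  then show ?thesis using assms(2) by (simp add: frechet_derivative_works)
qed

section \<open>Smooth separation of closed sets\<close>

definition flat_exp :: "real poly \<Rightarrow> real \<Rightarrow> real" where
  "flat_exp p t = (if 0 < t then poly p (1 / t) * exp (- 1 / t) else 0)"

lemma poly_times_exp_minus_tendsto_0:
  "((\<lambda>x. poly p x * exp (- x)) \<longlongrightarrow> (0::real)) at_top"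
proof -
  have "((\<lambda>x::real. coeff p i * (x ^ i / exp x)) \<longlongrightarrow> coeff p i * 0) at_top" for i
    by (intro tendsto_mult tendsto_const tendsto_power_div_exp_0)
  then have "((\<lambda>x::real. \<Sum>i\<le>degree p. coeff p i * (x ^ i / exp x)) \<longlongrightarrow> (\<Sum>i\<le>degree p. 0)) at_top"
    by (intro tendsto_sum) auto
  moreover have "(\<Sum>i\<le>degree p. coeff p i * (x ^ i / exp x)) = poly p x * exp (- x)" for x :: real
    by (simp add: poly_altdef sum_distrib_right exp_minus divide_inverse mult.assoc)
  ultimately show ?thesis by simp
qed

lemma flat_exp_tendsto_0: "(flat_exp p \<longlongrightarrow> 0) (at 0)"
proof -
  have "((\<lambda>t. poly p (inverse t) * exp (- inverse t)) \<longlongrightarrow> (0::real)) (at_right 0)"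
    by (rule filterlim_compose[OF poly_times_exp_minus_tendsto_0 filterlim_inverse_at_top_right])
  moreover have "eventually (\<lambda>t. poly p (inverse t) * exp (- inverse t) = flat_exp p t) (at_right 0)"
    by (auto simp: flat_exp_def eventually_at_filter divide_inverse)
  ultimately have "(flat_exp p \<longlongrightarrow> 0) (at_right 0)"
    using Lim_transform_eventually by fastforce
  moreover have "(flat_exp p \<longlongrightarrow> 0) (at_left 0)"
    by (rule tendsto_eventually) (auto simp: flat_exp_def eventually_at_filter)
  ultimately show ?thesis by (simp add: filterlim_at_split)
qed

lemma flat_exp_derivative:
  "(flat_exp p has_real_derivative flat_exp ([:0, 0, 1:] * (p - pderiv p)) t) (at t)"
proof (cases t "0::real" rule: linorder_cases)
  case less
  have "((\<lambda>t. 0) has_real_derivative 0) (at t)" by simp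
  then have "(flat_exp p has_real_derivative 0) (at t)"
    by (rule has_field_derivative_transform_within_open[where S="{..<0}"])
      (use less in \<open>auto simp: flat_exp_def\<close>)
  then show ?thesis using less by (simp add: flat_exp_def)
next
  case equal
  \<comment> \<open>The difference quotient at 0 is again a member of the family, with X p in place
    of p, so its limit is already known.\<close>
  have "((\<lambda>h. (flat_exp p (0 + h) - flat_exp p 0) / h) \<longlongrightarrow> 0) (at 0)"
  proof (rule Lim_transform_eventually[OF flat_exp_tendsto_0[of "[:0, 1:] * p"]])
    show "eventually (\<lambda>h. flat_exp ([:0, 1:] * p) h = (flat_exp p (0 + h) - flat_exp p 0) / h) (at 0)"
      by (auto simp: flat_exp_def eventually_at_filter)
  qed
  then have "(flat_exp p has_real_derivative 0) (at 0)" by (simp add: DERIV_def)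
  then show ?thesis using equal by (simp add: flat_exp_def)
next
  case greater
  have "((\<lambda>t. poly p (1 / t) * exp (- 1 / t)) has_real_derivative
      flat_exp ([:0, 0, 1:] * (p - pderiv p)) t) (at t)"
    using greater
    by (auto intro!: derivative_eq_intros simp: flat_exp_def field_simps power2_eq_square)
  then show ?thesis
    by (rule has_field_derivative_transform_within_open[where S="{0<..}"])
      (use greater in \<open>auto simp: flat_exp_def\<close>)
qed

lemma smooth_on_flat_exp: "smooth_on UNIV (flat_exp p)"
proof -
  have "Ck_on k UNIV (flat_exp p)" for k
  proof (induction k arbitrary: p)
    case 0
    show ?case using flat_exp_derivative[of p]
      by (auto intro!: continuous_at_imp_continuous_on DERIV_isCont)
  next
    case (Suc k)
    show ?case
      by (rule Ck_on_SucI[OF _ flat_exp_derivative[unfolded has_field_derivative_def]])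
        (auto intro!: Ck_on_bounded_linear[OF _ bounded_linear_mult_left] Suc.IH simp del: mult_pCons_left)
  qed
  then show ?thesis by (simp add: smooth_on_def)
qed

text \<open>The quotient f / (f + g), where f vanishes outside the large ball and g on the small
  one; they have no common zero. Both are built from the squared distance, which is smooth at the
  centre as well.\<close>

lemma smooth_bump:
  fixes a :: "'a::euclidean_space"
  assumes "0 < r"
  obtains \<psi> :: "'a \<Rightarrow> real" where "smooth_on UNIV \<psi>"
    "\<And>x. x \<in> ball a r \<Longrightarrow> \<psi> x = 1" "\<And>x. x \<notin> ball a (2 * r) \<Longrightarrow> \<psi> x = 0"
proof -
  define h where "h = flat_exp 1"
  have h: "h t = 0" if "t \<le> 0" for t using that by (simp add: h_def flat_exp_def)
  have hp: "h t > 0" if "t > 0" for t using that by (simp add: h_def flat_exp_def)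
  have hn: "h t \<ge> 0" for t using h hp by (metis less_eq_real_def not_le)
  define n where "n x = (x - a) \<bullet> (x - a)" for x
  define f g where "f x = h ((2 * r)\<^sup>2 - n x)" and "g x = h (n x - r\<^sup>2)" for x
  have n: "n x = (dist a x)\<^sup>2" for x
    by (simp add: n_def dist_norm power2_norm_eq_inner inner_diff_left inner_diff_right inner_commute)
  have sn: "smooth_on UNIV n"
    unfolding n_def
    by (intro smooth_on_bilinear[OF _ bounded_bilinear_inner] smooth_on_diff smooth_on_id smooth_on_const open_UNIV)
  have sf: "smooth_on UNIV f" unfolding f_def h_def
    by (rule smooth_on_compose[OF _ _ smooth_on_flat_exp])
       (auto intro!: smooth_on_diff smooth_on_const sn)
  have sg: "smooth_on UNIV g" unfolding g_def h_def
    by (rule smooth_on_compose[OF _ _ smooth_on_flat_exp])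
       (auto intro!: smooth_on_diff smooth_on_const sn)
  have pos: "f x + g x \<noteq> 0" for x
  proof (cases "n x < (2*r)\<^sup>2")
    case True
    then show ?thesis using hp[of "(2*r)\<^sup>2 - n x"] hn[of "n x - r\<^sup>2"] by (auto simp: f_def g_def)
  next
    case False
    moreover have "r\<^sup>2 < (2*r)\<^sup>2" using assms by (intro power_strict_mono) auto
    ultimately have "r\<^sup>2 < n x" by linarith
    then show ?thesis using hp[of "n x - r\<^sup>2"] hn[of "(2*r)\<^sup>2 - n x"] by (auto simp: f_def g_def)
  qed
  show ?thesis
  proof
    show "smooth_on UNIV (\<lambda>x. f x * inverse (f x + g x))"
      by (intro smooth_on_mult smooth_on_inverse smooth_on_add sf sg pos open_UNIV)
    show "f x * inverse (f x + g x) = 1" if "x \<in> ball a r" for x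
    proof -
      have "n x \<le> r\<^sup>2" unfolding n using that by (intro power_mono) auto
      then have "g x = 0" by (simp add: g_def h)
      then show ?thesis using pos[of x] by simp
    qed
    show "f x * inverse (f x + g x) = 0" if "x \<notin> ball a (2 * r)" for x
    proof -
      have "(2*r)\<^sup>2 \<le> n x" unfolding n using that assms by (intro power_mono) auto
      then show ?thesis by (simp add: f_def h)
    qed
  qed
qed

text \<open>A partition of unity on U whose members each live in a ball inside Y or inside Z;
  \<theta> is the sum of the members assigned to Z. Off Y only these members can be nonzero, and off
  Z all of them vanish.\<close>

lemma smooth_separation:
  fixes U :: "'a::euclidean_space set"
  assumes "open Y" "open Z" "U \<subseteq> Y \<union> Z"
  obtains \<theta> :: "'a \<Rightarrow> real" where "smooth_on U \<theta>"
    "\<And>x. x \<in> U - Y \<Longrightarrow> \<theta> x = 1" "\<And>x. x \<in> U - Z \<Longrightarrow> \<theta> x = 0"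
proof (cases "U = {}")
  case True
  then show ?thesis using that[of "\<lambda>_. 0"] by (simp add: smooth_on_const)
next
  case False
  have "\<exists>r>0. ball x (2 * r) \<subseteq> Y \<or> ball x (2 * r) \<subseteq> Z" if x: "x \<in> U" for x
  proof -
    have "x \<in> Y \<or> x \<in> Z" using assms(3) x by auto
    then obtain e where "0 < e" "ball x e \<subseteq> Y \<or> ball x e \<subseteq> Z"
      using openE[OF assms(1)] openE[OF assms(2)] by metis
    then show ?thesis by (intro exI[of _ "e / 2"]) simp
  qed
  then obtain r where r: "\<And>x. x \<in> U \<Longrightarrow> 0 < r x"
      "\<And>x. x \<in> U \<Longrightarrow> ball x (2 * r x) \<subseteq> Y \<or> ball x (2 * r x) \<subseteq> Z"
    by metis
  obtain \<F> where \<F>: "\<F> \<subseteq> (\<lambda>x. ball x (r x)) ` U" "countable \<F>" "\<Union>\<F> = (\<Union>x\<in>U. ball x (r x))"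
    using Lindelof[of "(\<lambda>x. ball x (r x)) ` U"] by auto
  obtain C where C: "countable C" "C \<subseteq> U" "\<F> = (\<lambda>x. ball x (r x)) ` C"
    using countable_subset_image[of \<F> "\<lambda>x. ball x (r x)" U] \<F>(1,2) by auto
  have cover: "U \<subseteq> (\<Union>x\<in>C. ball x (r x))"
  proof
    fix x assume x: "x \<in> U"
    then have "x \<in> ball x (r x)" using r(1) by simp
    then have "x \<in> \<Union>\<F>" unfolding \<F>(3) using x by (rule UN_I[rotated])
    then show "x \<in> (\<Union>x\<in>C. ball x (r x))" unfolding C(3) .
  qed
  with False have "C \<noteq> {}" by auto
  \<comment> \<open>If C is finite the enumeration repeats balls, which is harmless: the argument
    does not use that they are distinct.\<close>
  define e where "e = from_nat_into C"
  have e: "range e = C" unfolding e_def by (rule range_from_nat_into[OF \<open>C \<noteq> {}\<close> C(1)])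
  then have eU: "e k \<in> U" for k using C(2) by auto
  have "\<exists>\<psi>::'a \<Rightarrow> real. smooth_on UNIV \<psi> \<and> (\<forall>x\<in>ball (e k) (r (e k)). \<psi> x = 1) \<and>
      (\<forall>x. x \<notin> ball (e k) (2 * r (e k)) \<longrightarrow> \<psi> x = 0)" for k
    by (rule smooth_bump[OF r(1)[OF eU[of k]], of "e k"]) auto
  then obtain \<psi> :: "nat \<Rightarrow> 'a \<Rightarrow> real" where \<psi>: "\<And>k. smooth_on UNIV (\<psi> k)"
      "\<And>k x. x \<in> ball (e k) (r (e k)) \<Longrightarrow> \<psi> k x = 1"
      "\<And>k x. x \<notin> ball (e k) (2 * r (e k)) \<Longrightarrow> \<psi> k x = 0"
    by metis
  \<comment> \<open>The share of ball k that earlier balls have left over. As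
    \<open>\<psi> m\<close> is 1 on the m-th small ball, all later shares vanish there, which gives
    local finiteness.\<close>
  define \<phi> where "\<phi> k x = \<psi> k x * (\<Prod>j<k. 1 - \<psi> j x)" for k x
  define K where "K = {k. ball (e k) (2 * r (e k)) \<subseteq> Z}"
  \<comment> \<open>Only points of U matter, and there the series is a finite sum. Elsewhere the
    value of \<open>suminf\<close> is of no concern.\<close>
  define \<theta> where "\<theta> x = (\<Sum>k. if k \<in> K then \<phi> k x else 0)" for x
  have \<phi>0: "\<phi> k x = 0" if "x \<in> ball (e m) (r (e m))" "m < k" for k m x
    using that(2) \<psi>(2)[OF that(1)] unfolding \<phi>_def by (simp add: prod_zero_iff) blast
  have \<theta>: "\<theta> x = (\<Sum>k\<le>m. if k \<in> K then \<phi> k x else 0)" if "x \<in> ball (e m) (r (e m))" for x m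
    unfolding \<theta>_def using \<phi>0[OF that] by (intro suminf_finite) auto
  have \<phi>_smooth: "smooth_on UNIV (\<phi> k)" for k
    unfolding \<phi>_def
    by (intro smooth_on_mult smooth_on_prod smooth_on_diff smooth_on_const \<psi>(1) open_UNIV)
  \<comment> \<open>On the m-th small ball the product contains the factor 1 -
    \<open>\<psi> m x\<close> = 0, so the shares add up to 1.\<close>
  have telescope: "(\<Sum>k\<le>m. \<phi> k x) = 1 - (\<Prod>j\<le>m. 1 - \<psi> j x)" for m x
  proof (induction m)
    case (Suc m)
    show ?case
      unfolding sum.atMost_Suc Suc.IH prod.atMost_Suc
      by (simp add: \<phi>_def lessThan_Suc_atMost algebra_simps)
  qed (simp add: \<phi>_def)
  have in_ball: "\<exists>m. x \<in> ball (e m) (r (e m))" if "x \<in> U" for x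
    using subsetD[OF cover that] unfolding e[symmetric] by simp
  show ?thesis
  proof
    show "smooth_on U \<theta>"
    proof (rule smooth_on_local)
      fix x assume "x \<in> U"
      then obtain m where m: "x \<in> ball (e m) (r (e m))" using in_ball by blast
      have "smooth_on (ball (e m) (r (e m))) (\<lambda>x. \<Sum>k\<le>m. if k \<in> K then \<phi> k x else 0)"
      proof (rule smooth_on_sum)
        show "smooth_on (ball (e m) (r (e m))) (\<lambda>x. if k \<in> K then \<phi> k x else 0)" for k
          by (cases "k \<in> K") (auto simp: smooth_on_const intro: smooth_on_subset[OF \<phi>_smooth])
      qed simp
      then have "smooth_on (ball (e m) (r (e m))) \<theta>"
        using smooth_on_cong[OF open_ball, of "e m" "r (e m)" \<theta>, OF \<theta>[of _ m]] by blast
      then show "\<exists>T. open T \<and> x \<in> T \<and> smooth_on T \<theta>" using m by blast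
    qed
    show "\<theta> x = 1" if x: "x \<in> U - Y" for x
    proof -
      obtain m where m: "x \<in> ball (e m) (r (e m))" using in_ball x by blast
      have "\<phi> k x = 0" if "k \<notin> K" for k
      proof -
        have "ball (e k) (2 * r (e k)) \<subseteq> Y" using that r(2)[OF eU[of k]] by (auto simp: K_def)
        then have "\<psi> k x = 0" using x by (intro \<psi>(3)) auto
        then show ?thesis by (simp add: \<phi>_def)
      qed
      then have "\<theta> x = (\<Sum>k\<le>m. \<phi> k x)"
        unfolding \<theta>[OF m] by (intro sum.cong) auto
      also have "\<dots> = 1" using \<psi>(2)[OF m] by (auto simp: telescope)
      finally show ?thesis .
    qed
    show "\<theta> x = 0" if x: "x \<in> U - Z" for x
    proof -
      have "\<phi> k x = 0" if "k \<in> K" for k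
      proof -
        have "\<psi> k x = 0" using that x by (intro \<psi>(3)) (auto simp: K_def)
        then show ?thesis by (simp add: \<phi>_def)
      qed
      then have "(\<lambda>k. if k \<in> K then \<phi> k x else 0) = (\<lambda>k. 0)" by auto
      then show ?thesis unfolding \<theta>_def by simp
    qed
  qed
qed

section \<open>Symmetry of second derivatives and \<open>dbar_dir\<close>\<close>

text \<open>Differentiability does not enter: \<open>frechet_derivative\<close> chooses among the
  derivatives, and both functions have the same ones, possibly none.\<close>

lemma frechet_derivative_cong:
  assumes "open T" "x \<in> T" "\<And>y. y \<in> T \<Longrightarrow> f y = g y"
  shows "frechet_derivative f (at x) = frechet_derivative g (at x)"
proof -
  have "(f has_derivative D) (at x) \<longleftrightarrow> (g has_derivative D) (at x)" for D
    using has_derivative_transform_within_open[OF _ assms(1,2), of f D UNIV g]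
      has_derivative_transform_within_open[OF _ assms(1,2), of g D UNIV f] assms(3) by metis
  then show ?thesis unfolding frechet_derivative_def by simp
qed

lemma has_real_derivative_along_line:
  assumes "(f has_derivative D) (at (p + t *\<^sub>R v))"
  shows "((\<lambda>t. f (p + t *\<^sub>R v)) has_real_derivative D v) (at t)"
proof -
  have "((\<lambda>t. p + t *\<^sub>R v) has_derivative (\<lambda>h. h *\<^sub>R v)) (at t)"
    by (auto intro!: derivative_eq_intros)
  then have "((\<lambda>t. f (p + t *\<^sub>R v)) has_derivative (\<lambda>h. D (h *\<^sub>R v))) (at t)"
    by (rule has_derivative_compose) (rule assms)
  moreover have "D (h *\<^sub>R v) = D v * h" for h
    using linear_scale[OF has_derivative_linear[OF assms], of h v] by simp
  ultimately show ?thesis by (simp add: has_field_derivative_def)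
qed

text \<open>The mean value theorem twice: along v for the difference of f on the two sides of the
  parallelogram, then along w for the v-derivative of f.\<close>

lemma second_difference_mean_value:
  fixes f :: "'a::real_normed_vector \<Rightarrow> real"
  assumes "smooth_on S f" "0 < s"
    and sub: "\<And>a b. 0 \<le> a \<Longrightarrow> a \<le> s \<Longrightarrow> 0 \<le> b \<Longrightarrow> b \<le> s \<Longrightarrow> x + a *\<^sub>R v + b *\<^sub>R w \<in> S"
  obtains a b where "0 < a" "a < s" "0 < b" "b < s"
    "f (x + s *\<^sub>R v + s *\<^sub>R w) - f (x + s *\<^sub>R v) - f (x + s *\<^sub>R w) + f x =
      s\<^sup>2 * frechet_derivative (\<lambda>y. frechet_derivative f (at y) v) (at (x + a *\<^sub>R v + b *\<^sub>R w)) w"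
proof -
  let ?D = "\<lambda>y. frechet_derivative f (at y) v"
  let ?D2 = "\<lambda>y. frechet_derivative ?D (at y) w"
  define g where "g t = f ((x + s *\<^sub>R w) + t *\<^sub>R v) - f (x + t *\<^sub>R v)" for t
  have "(g has_real_derivative (?D (x + s *\<^sub>R w + t *\<^sub>R v) - ?D (x + t *\<^sub>R v))) (at t)"
    if "0 \<le> t" "t \<le> s" for t
  proof -
    have "x + s *\<^sub>R w + t *\<^sub>R v \<in> S" "x + t *\<^sub>R v \<in> S"
      using sub[of t s] sub[of t 0] that assms(2) by (auto simp: algebra_simps)
    then show ?thesis unfolding g_def
      by (intro DERIV_diff has_real_derivative_along_line smooth_on_has_derivative[OF assms(1)])
  qed
  then obtain a where a: "0 < a" "a < s"
      "g s - g 0 = (s - 0) * (?D (x + s *\<^sub>R w + a *\<^sub>R v) - ?D (x + a *\<^sub>R v))"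
    using MVT2[OF assms(2), of g "\<lambda>t. ?D (x + s *\<^sub>R w + t *\<^sub>R v) - ?D (x + t *\<^sub>R v)"] by blast
  have "((\<lambda>b. ?D ((x + a *\<^sub>R v) + b *\<^sub>R w)) has_real_derivative ?D2 ((x + a *\<^sub>R v) + b *\<^sub>R w)) (at b)"
    if "0 \<le> b" "b \<le> s" for b
  proof -
    have "x + a *\<^sub>R v + b *\<^sub>R w \<in> S" using sub[of a b] that a by auto
    then show ?thesis
      by (intro has_real_derivative_along_line
          smooth_on_has_derivative[OF smooth_on_directional[OF assms(1)]])
  qed
  then obtain b where b: "0 < b" "b < s"
      "?D ((x + a *\<^sub>R v) + s *\<^sub>R w) - ?D ((x + a *\<^sub>R v) + 0 *\<^sub>R w) = (s - 0) * ?D2 ((x + a *\<^sub>R v) + b *\<^sub>R w)"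
    using MVT2[OF assms(2), of "\<lambda>b. ?D ((x + a *\<^sub>R v) + b *\<^sub>R w)" "\<lambda>b. ?D2 ((x + a *\<^sub>R v) + b *\<^sub>R w)"]
    by blast
  have "f (x + s *\<^sub>R v + s *\<^sub>R w) - f (x + s *\<^sub>R v) - f (x + s *\<^sub>R w) + f x = g s - g 0"
    by (simp add: g_def algebra_simps)
  also have "\<dots> = s * (?D ((x + a *\<^sub>R v) + s *\<^sub>R w) - ?D ((x + a *\<^sub>R v) + 0 *\<^sub>R w))"
    using a(3) by (simp add: algebra_simps)
  also have "\<dots> = s\<^sup>2 * ?D2 (x + a *\<^sub>R v + b *\<^sub>R w)"
    using b(3) by (simp add: power2_eq_square)
  finally show ?thesis using that[OF a(1,2) b(1,2)] by blast
qed

text \<open>The second difference is symmetric in v and w. Divided by s^2 it is a value of either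
  mixed derivative at some point near x, so the two would be close to each other there; continuity
  at x excludes a gap between them.\<close>

lemma symmetric_second_derivative_real:
  fixes f :: "'a::real_normed_vector \<Rightarrow> real"
  assumes "open S" "smooth_on S f" "x \<in> S"
  shows "frechet_derivative (\<lambda>y. frechet_derivative f (at y) v) (at x) w =
    frechet_derivative (\<lambda>y. frechet_derivative f (at y) w) (at x) v"
proof (rule ccontr)
  let ?P = "\<lambda>v w y. frechet_derivative (\<lambda>y. frechet_derivative f (at y) v) (at y) w"
  assume "\<not> ?thesis"
  then have e: "0 < dist (?P v w x) (?P w v x) / 2" (is "0 < ?e") by simp
  have cont: "isCont (?P v w) x" for v w
    using smooth_on_has_derivative[OF smooth_on_directional[OF smooth_on_directional[OF assms(2)]] assms(3)]
    by (rule has_derivative_continuous)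
  obtain d0 where d0: "0 < d0" "ball x d0 \<subseteq> S" using assms openE by blast
  obtain d1 where d1: "0 < d1" "\<And>y. dist y x < d1 \<Longrightarrow> dist (?P v w y) (?P v w x) < ?e"
    using cont[of v w] e unfolding continuous_at_eps_delta by blast
  obtain d2 where d2: "0 < d2" "\<And>y. dist y x < d2 \<Longrightarrow> dist (?P w v y) (?P w v x) < ?e"
    using cont[of w v] e unfolding continuous_at_eps_delta by blast
  define d where "d = min d0 (min d1 d2)"
  have d: "0 < d" using d0 d1 d2 by (simp add: d_def)
  \<comment> \<open>This size keeps the whole parallelogram inside the ball of radius d; the summand
    1 covers the case v = w = 0.\<close>
  define s where "s = d / (norm v + norm w + 1)"
  have s: "0 < s" using d by (simp add: s_def add_nonneg_pos)
  \<comment> \<open>Stated for v', w' so that it serves both orders of the two directions.\<close>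
  have near: "dist (x + a *\<^sub>R v' + b *\<^sub>R w') x < d"
    if "0 \<le> a" "a \<le> s" "0 \<le> b" "b \<le> s" "norm v' + norm w' = norm v + norm w" for a b v' w'
  proof -
    have "dist (x + a *\<^sub>R v' + b *\<^sub>R w') x = norm (a *\<^sub>R v' + b *\<^sub>R w')"
      by (simp add: dist_norm)
    also have "\<dots> \<le> a * norm v' + b * norm w'"
      using that by (intro order_trans[OF norm_triangle_ineq]) simp
    also have "\<dots> \<le> s * norm v' + s * norm w'"
      using that by (intro add_mono mult_right_mono) auto
    also have "\<dots> = s * (norm v + norm w)"
      using that(5) by (simp add: distrib_left[symmetric])
    also have "\<dots> < s * (norm v + norm w + 1)" using s by simp
    also have "\<dots> = d" using d by (simp add: s_def add_nonneg_eq_0_iff)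
    finally show ?thesis .
  qed
  have sub: "x + a *\<^sub>R v' + b *\<^sub>R w' \<in> S"
    if "0 \<le> a" "a \<le> s" "0 \<le> b" "b \<le> s" "norm v' + norm w' = norm v + norm w" for a b v' w'
    using near[OF that] d0(2) by (auto simp: d_def dist_commute)
  obtain a b where ab: "0 < a" "a < s" "0 < b" "b < s"
    "f (x + s *\<^sub>R v + s *\<^sub>R w) - f (x + s *\<^sub>R v) - f (x + s *\<^sub>R w) + f x =
      s\<^sup>2 * ?P v w (x + a *\<^sub>R v + b *\<^sub>R w)"
    using second_difference_mean_value[OF assms(2) s, of x v w] sub by blast
  obtain a' b' where ab': "0 < a'" "a' < s" "0 < b'" "b' < s"
    "f (x + s *\<^sub>R w + s *\<^sub>R v) - f (x + s *\<^sub>R w) - f (x + s *\<^sub>R v) + f x =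
      s\<^sup>2 * ?P w v (x + a' *\<^sub>R w + b' *\<^sub>R v)"
    using second_difference_mean_value[OF assms(2) s, of x w v] sub by (metis add.commute)
  have "s\<^sup>2 * ?P v w (x + a *\<^sub>R v + b *\<^sub>R w) = s\<^sup>2 * ?P w v (x + a' *\<^sub>R w + b' *\<^sub>R v)"
    unfolding ab(5)[symmetric] ab'(5)[symmetric] by (simp add: algebra_simps)
  then have eq: "?P v w (x + a *\<^sub>R v + b *\<^sub>R w) = ?P w v (x + a' *\<^sub>R w + b' *\<^sub>R v)"
    using s by simp
  have "dist (?P v w (x + a *\<^sub>R v + b *\<^sub>R w)) (?P v w x) < ?e"
    using near[of a b v w] ab by (intro d1) (simp add: d_def)
  moreover have "dist (?P w v (x + a' *\<^sub>R w + b' *\<^sub>R v)) (?P w v x) < ?e"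
    using near[of a' b' w v] ab' by (intro d2) (simp add: d_def)
  ultimately show False unfolding eq using dist_triangle2[of "?P v w x" "?P w v x"]
    by (smt (verit) dist_commute dist_triangle field_sum_of_halves)
qed

text \<open>The mean value theorem is confined to real values, so the general case is reduced to
  coordinates.\<close>

lemma symmetric_second_derivative:
  fixes f :: "'a::real_normed_vector \<Rightarrow> 'b::euclidean_space"
  assumes "open S" "smooth_on S f" "x \<in> S"
  shows "frechet_derivative (\<lambda>y. frechet_derivative f (at y) v) (at x) w =
    frechet_derivative (\<lambda>y. frechet_derivative f (at y) w) (at x) v"
proof (rule euclidean_eqI)
  fix b :: 'b
  have 1: "frechet_derivative (\<lambda>y. g y \<bullet> b) (at y) v = frechet_derivative g (at y) v \<bullet> b"
    if "smooth_on S g" "y \<in> S" for y v and g :: "'a \<Rightarrow> 'b"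
    using bounded_linear.has_derivative[OF bounded_linear_inner_left
        smooth_on_has_derivative[OF that], of b] by (metis frechet_derivative_at)
  have 2: "frechet_derivative (\<lambda>y. frechet_derivative f (at y) v) (at x) w \<bullet> b =
    frechet_derivative (\<lambda>y. frechet_derivative (\<lambda>y. f y \<bullet> b) (at y) v) (at x) w" for v w
    using frechet_derivative_cong[OF assms(1,3), of "\<lambda>y. frechet_derivative (\<lambda>y. f y \<bullet> b) (at y) v"
        "\<lambda>y. frechet_derivative f (at y) v \<bullet> b"]
    by (simp add: 1 smooth_on_directional assms(2,3))
  show "frechet_derivative (\<lambda>y. frechet_derivative f (at y) v) (at x) w \<bullet> b =
    frechet_derivative (\<lambda>y. frechet_derivative f (at y) w) (at x) v \<bullet> b"
    unfolding 2
    by (rule symmetric_second_derivative_real[OF assms(1) _ assms(3)])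
      (rule smooth_on_bounded_linear[OF assms(1) bounded_linear_inner_left assms(2)])
qed

section \<open>The conjugate linear part of the derivative\<close>

lemma dbar_dir_cong:
  assumes "open T" "z \<in> T" "\<And>y. y \<in> T \<Longrightarrow> f y = g y"
  shows "dbar_dir f z = dbar_dir g z"
  using frechet_derivative_cong[OF assms] unfolding dbar_dir_def by simp

lemma dbar_dir_has_derivative:
  "(f has_derivative D) (at z) \<Longrightarrow> dbar_dir f z v = (D v + \<i> * D (\<i> *s v)) / 2"
  unfolding dbar_dir_def by (metis frechet_derivative_at)

lemma dbar_dir_const: "dbar_dir (\<lambda>z. c) z v = 0"
  by (simp add: dbar_dir_def)

lemma dbar_dir_add:
  assumes "f differentiable at z" "g differentiable at z"
  shows "dbar_dir (\<lambda>z. f z + g z) z v = dbar_dir f z v + dbar_dir g z v"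
  using has_derivative_add[OF assms[unfolded frechet_derivative_works]]
  by (subst dbar_dir_has_derivative) (auto simp: dbar_dir_def field_simps)

lemma dbar_dir_mult:
  assumes "f differentiable at z" "g differentiable at z"
  shows "dbar_dir (\<lambda>z. f z * g z) z v = f z * dbar_dir g z v + dbar_dir f z v * g z"
  using has_derivative_mult[OF assms[unfolded frechet_derivative_works]]
  by (subst dbar_dir_has_derivative) (auto simp: dbar_dir_def field_simps)

lemma dbar_dir_cmult:
  assumes "g differentiable at z"
  shows "dbar_dir (\<lambda>z. c * g z) z v = c * dbar_dir g z v"
  using dbar_dir_mult[of "\<lambda>_. c" z g] assms by (simp add: dbar_dir_const)

lemma dbar_dir_diff:
  assumes "f differentiable at z" "g differentiable at z"
  shows "dbar_dir (\<lambda>z. f z - g z) z v = dbar_dir f z v - dbar_dir g z v"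
  using has_derivative_diff[OF assms[unfolded frechet_derivative_works]]
  by (subst dbar_dir_has_derivative) (auto simp: dbar_dir_def field_simps)

lemma dbar_dir_sum:
  assumes "\<And>i. i \<in> I \<Longrightarrow> f i differentiable at z"
  shows "dbar_dir (\<lambda>z. \<Sum>i\<in>I. f i z) z v = (\<Sum>i\<in>I. dbar_dir (f i) z v)"
  using assms
  by (induction I rule: infinite_finite_induct) (simp_all add: dbar_dir_const dbar_dir_add)

text \<open>Composition with a complex linear L commutes with taking the conjugate linear part. This
  makes the dbar derivative of a function independent of holomorphic coordinates.\<close>

lemma dbar_dir_compose_holo:
  assumes "(g has_derivative L) (at z)" "f differentiable at (g z)" "\<And>v. L (\<i> *s v) = \<i> *s L v"
  shows "dbar_dir (\<lambda>z. f (g z)) z v = dbar_dir f (g z) (L v)"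
  using has_derivative_compose[OF assms(1) assms(2)[unfolded frechet_derivative_works]]
  by (subst dbar_dir_has_derivative) (auto simp: dbar_dir_def assms(3))

lemma smooth_on_differentiable: "smooth_on S f \<Longrightarrow> x \<in> S \<Longrightarrow> f differentiable at x"
  using smooth_on_has_derivative by (auto simp: differentiable_def)

lemma smooth_on_dbar_dir:
  assumes "open S" "smooth_on S f"
  shows "smooth_on S (\<lambda>z. dbar_dir f z v)"
proof -
  have "smooth_on S (\<lambda>z. (1/2) * (frechet_derivative f (at z) v + \<i> * frechet_derivative f (at z) (\<i> *s v)))"
    by (intro smooth_on_mult smooth_on_add smooth_on_const smooth_on_directional assms)
  then show ?thesis by (simp add: dbar_dir_def)
qed

lemma linear_scale_i_twice:
  fixes v :: "complex^'n"
  assumes "linear D"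
  shows "D (\<i> *s (\<i> *s v)) = - D v"
proof -
  have "\<i> *s (\<i> *s v) = - v" by (simp add: vec_eq_iff)
  then show ?thesis using linear_neg[OF assms] by simp
qed

text \<open>D respects real scalars only, so a is split into real and imaginary part, and
  multiplication by i exchanges the two terms of \<open>dbar_dir\<close> up to the factor
  -i.\<close>

lemma dbar_dir_conj_linear:
  assumes "f differentiable at z"
  shows "dbar_dir f z (a *s v + w) = cnj a * dbar_dir f z v + dbar_dir f z w"
proof -
  let ?D = "frechet_derivative f (at z)"
  have D: "linear ?D" using assms by (simp add: frechet_derivative_works has_derivative_linear)
  have D_scale: "?D (a *s u) = Re a * ?D u + Im a * ?D (\<i> *s u)" for u
  proof -
    have "a *s u = Re a *\<^sub>R u + Im a *\<^sub>R (\<i> *s u)"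
      by (simp add: vec_eq_iff complex_eq_iff)
    then have "?D (a *s u) = Re a *\<^sub>R ?D u + Im a *\<^sub>R ?D (\<i> *s u)"
      by (simp only: linear_add[OF D] linear_scale[OF D])
    then show ?thesis by (simp add: scaleR_conv_of_real)
  qed
  have "\<i> *s (a *s v + w) = a *s (\<i> *s v) + \<i> *s w"
    by (simp add: vec_eq_iff algebra_simps)
  then have "?D (\<i> *s (a *s v + w)) = Re a * ?D (\<i> *s v) - Im a * ?D v + ?D (\<i> *s w)"
    by (simp only: linear_add[OF D] D_scale linear_scale_i_twice[OF D]) simp
  moreover have "?D (a *s v + w) = Re a * ?D v + Im a * ?D (\<i> *s v) + ?D w"
    by (simp only: linear_add[OF D] D_scale)
  ultimately show ?thesis
    by (simp add: dbar_dir_def complex_eq_iff field_simps)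
qed

text \<open>Both sides expand into the same four second derivatives, along v or iv and w or iw, each
  of which is symmetric. This is the analytic content of dbar dbar = 0.\<close>

lemma dbar_dir_commute:
  assumes "open S" "smooth_on S f" "z \<in> S"
  shows "dbar_dir (\<lambda>z. dbar_dir f z v) z w = dbar_dir (\<lambda>z. dbar_dir f z w) z v"
proof -
  let ?D = "\<lambda>v y. frechet_derivative f (at y) v"
  have D: "(?D v has_derivative frechet_derivative (?D v) (at z)) (at z)" for v
    by (rule smooth_on_has_derivative[OF smooth_on_directional[OF assms(2)] assms(3)])
  have "((\<lambda>z. (?D v z + \<i> * ?D (\<i> *s v) z) / 2) has_derivative
     (\<lambda>u. (frechet_derivative (?D v) (at z) u + \<i> * frechet_derivative (?D (\<i> *s v)) (at z) u) / 2)) (at z)" for v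
    using D[of v] D[of "\<i> *s v"] by (auto intro!: derivative_eq_intros)
  then have twice: "dbar_dir (\<lambda>z. dbar_dir f z v) z w =
     (frechet_derivative (?D v) (at z) w + \<i> * frechet_derivative (?D (\<i> *s v)) (at z) w
      + \<i> * (frechet_derivative (?D v) (at z) (\<i> *s w) + \<i> * frechet_derivative (?D (\<i> *s v)) (at z) (\<i> *s w))) / 4"
    for v w
    by (subst dbar_dir_def[of f, abs_def], subst dbar_dir_has_derivative) auto
  note sym = symmetric_second_derivative[OF assms]
  show ?thesis
    unfolding twice
    using sym[of v w] sym[of "\<i> *s v" w] sym[of v "\<i> *s w"] sym[of "\<i> *s v" "\<i> *s w"]
    by (simp add: algebra_simps)
qed

section \<open>Exterior product with a conjugate linear functional\<close>

text \<open>The hat over an argument in alternating sums; the body repeats the argument list in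
  \<open>dbar\<close>, so that \<open>dbar\<close> can be folded to it.\<close>

definition omit :: "nat \<Rightarrow> 'b list \<Rightarrow> 'b list" where
  "omit i vs = take i vs @ drop (Suc i) vs"

lemma length_omit: "i < length vs \<Longrightarrow> length (omit i vs) = length vs - 1"
  by (simp add: omit_def)

lemma nth_omit: "j < length vs - 1 \<Longrightarrow> i < length vs \<Longrightarrow> omit i vs ! j = (if j < i then vs ! j else vs ! Suc j)"
  by (auto simp: omit_def nth_append min_def)

lemma map_omit: "map f (omit i vs) = omit i (map f vs)"
  by (simp add: omit_def take_map drop_map)

lemma omit_update_same: "omit i (vs[i := v]) = omit i vs"
  by (simp add: omit_def)

lemma omit_update:
  assumes "i < length vs" "j < length vs" "i \<noteq> j"
  shows "omit i (vs[j := v]) = (omit i vs)[(if j < i then j else j - 1) := v]"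
  using assms by (intro nth_equalityI) (auto simp: length_omit nth_omit nth_list_update)

text \<open>The simplicial identity for face maps. It identifies the lists in the two terms that
  cancel in dbar dbar.\<close>

lemma omit_omit:
  assumes "j < i" "i < length vs"
  shows "omit j (omit i vs) = omit (i - 1) (omit j vs)"
  using assms by (intro nth_equalityI) (auto simp: length_omit nth_omit)

lemma conj_alt_length: "conj_alt q \<alpha> \<Longrightarrow> int (length vs) \<noteq> q \<Longrightarrow> \<alpha> vs = 0"
  by (simp add: conj_alt_def)

lemma conj_alt_linear:
  "conj_alt q \<alpha> \<Longrightarrow> i < length vs \<Longrightarrow> \<alpha> (vs[i := a *s v + w]) = cnj a * \<alpha> (vs[i := v]) + \<alpha> (vs[i := w])"
  by (simp add: conj_alt_def)

lemma conj_alt_repeated: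
  "conj_alt q \<alpha> \<Longrightarrow> i < j \<Longrightarrow> j < length vs \<Longrightarrow> vs ! i = vs ! j \<Longrightarrow> \<alpha> vs = 0"
  unfolding conj_alt_def by blast

text \<open>Polarization: the value with x + y in both neighbouring slots is zero and expands into
  four terms, two of which are zero themselves.\<close>

lemma conj_alt_swap:
  assumes "conj_alt q \<alpha>"
  shows "\<alpha> (us @ x # y # ws) = - \<alpha> (us @ y # x # ws)"
proof -
  have add2: "\<alpha> (us @ z # (x + y) # ws) = \<alpha> (us @ z # x # ws) + \<alpha> (us @ z # y # ws)" for z
    using conj_alt_linear[OF assms, of "Suc (length us)" "us @ z # x # ws" 1 x y]
    by (simp add: list_update_append)
  have add1: "\<alpha> (us @ (x + y) # z # ws) = \<alpha> (us @ x # z # ws) + \<alpha> (us @ y # z # ws)" for z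
    using conj_alt_linear[OF assms, of "length us" "us @ x # z # ws" 1 x y] by simp
  have "\<alpha> (us @ z # z # ws) = 0" for z
    by (rule conj_alt_repeated[OF assms, of "length us" "Suc (length us)"]) (auto simp: nth_append)
  from this[of "x + y"] this[of x] this[of y] show ?thesis
    unfolding add1 add2 by (simp add: add_eq_0_iff)
qed

lemma conj_alt_move:
  assumes "conj_alt q \<alpha>"
  shows "\<alpha> (us @ x # ms @ ws) = (- 1) ^ length ms * \<alpha> (us @ ms @ x # ws)"
proof (induction ms arbitrary: us)
  case (Cons m ms)
  have "\<alpha> (us @ x # m # ms @ ws) = - \<alpha> ((us @ [m]) @ x # ms @ ws)"
    using conj_alt_swap[OF assms, of us x m "ms @ ws"] by simp
  also have "\<dots> = - ((- 1) ^ length ms * \<alpha> ((us @ [m]) @ ms @ x # ws))"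
    unfolding Cons.IH ..
  finally show ?case by simp
qed simp

text \<open>The exterior product with the covector \<beta> in front, without factorials. It has the
  shape of \<open>dbar\<close>, so that the Leibniz rule reads dbar (\<theta> \<omega>) = \<theta>
  dbar \<omega> + (dbar \<theta>) wedge \<omega>.\<close>

definition wedge :: "('b \<Rightarrow> complex) \<Rightarrow> ('b list \<Rightarrow> complex) \<Rightarrow> 'b list \<Rightarrow> complex" where
  "wedge \<beta> \<alpha> vs = (\<Sum>i<length vs. (- 1) ^ i * (\<beta> (vs ! i) * \<alpha> (omit i vs)))"

text \<open>The point is alternation: if entries a and b agree, every term omitting neither still
  contains a repetition and is zero, and the two remaining terms cancel.\<close>

lemma conj_alt_wedge:
  fixes \<alpha> :: "(complex^'a) list \<Rightarrow> complex"
  assumes \<alpha>: "conj_alt q \<alpha>"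
    and \<beta>: "\<And>a v w. \<beta> (a *s v + w) = cnj a * \<beta> v + \<beta> w"
  shows "conj_alt (q + 1) (wedge \<beta> \<alpha>)"
  unfolding conj_alt_def
proof (intro conjI allI impI)
  fix vs :: "(complex^'a) list" assume "int (length vs) \<noteq> q + 1"
  then have "\<alpha> (omit i vs) = 0" if "i < length vs" for i
    using that by (intro conj_alt_length[OF \<alpha>]) (auto simp: length_omit of_nat_diff)
  then show "wedge \<beta> \<alpha> vs = 0" by (simp add: wedge_def)
next
  fix vs :: "(complex^'a) list" and j a v w assume j: "j < length vs"
  have "\<beta> (vs[j := a *s v + w] ! i) * \<alpha> (omit i (vs[j := a *s v + w])) =
      cnj a * (\<beta> (vs[j := v] ! i) * \<alpha> (omit i (vs[j := v]))) + \<beta> (vs[j := w] ! i) * \<alpha> (omit i (vs[j := w]))"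
    if i: "i < length vs" for i
  proof (cases "i = j")
    case True
    then show ?thesis using j by (simp add: omit_update_same \<beta>) (simp add: algebra_simps)
  next
    case False
    have "(if j < i then j else j - 1) < length (omit i vs)"
      using i j False by (auto simp: length_omit)
    note lin = conj_alt_linear[OF \<alpha> this]
    show ?thesis using False by (simp only: omit_update[OF i j False] lin nth_list_update_neq) (simp add: algebra_simps)
  qed
  then show "wedge \<beta> \<alpha> (vs[j := a *s v + w]) = cnj a * wedge \<beta> \<alpha> (vs[j := v]) + wedge \<beta> \<alpha> (vs[j := w])"
    unfolding wedge_def sum_distrib_left
    by (simp add: sum.distrib[symmetric]) (intro sum.cong refl, simp add: algebra_simps)
next
  fix vs :: "(complex^'a) list" and a b
  assume ab: "a < b \<and> b < length vs \<and> vs ! a = vs ! b"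
  let ?T = "\<lambda>i. (- 1) ^ i * (\<beta> (vs ! i) * \<alpha> (omit i vs))"
  have "?T i = 0" if i: "i < length vs" "i \<noteq> a" "i \<noteq> b" for i
  proof -
    \<comment> \<open>Omitting entry i lowers later positions by one; the repeated vector sits at
      \<open>?s a\<close> and \<open>?s b\<close> of the shortened list.\<close>
    let ?s = "\<lambda>j. if j < i then j else j - 1"
    have "\<alpha> (omit i vs) = 0"
    proof (rule conj_alt_repeated[OF \<alpha>])
      show "?s a < ?s b" "?s b < length (omit i vs)" using ab i by (auto simp: length_omit)
      then show "omit i vs ! ?s a = omit i vs ! ?s b"
        using ab i by (auto simp: nth_omit length_omit)
    qed
    then show ?thesis by simp
  qed
  then have "(\<Sum>i<length vs. ?T i) = (\<Sum>i\<in>{a, b}. ?T i)"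
    using ab by (intro sum.mono_neutral_right) auto
  also have "\<dots> = ?T a + ?T b" using ab by simp
  also have "\<dots> = 0"
  proof -
    \<comment> \<open>With x the repeated vector, vs = us, x, ms, x, ws. The two shortened lists
      differ by moving x past ms, which costs (-1)^(b-a-1), while the signs of the two terms differ
      by (-1)^(b-a).\<close>
    define us ms ws where "us = take a vs" and "ms = take (b - a - 1) (drop (Suc a) vs)"
      and "ws = drop (Suc b) vs"
    have ms: "length ms = b - a - 1" using ab by (auto simp: ms_def min_def)
    have tail: "drop (Suc a) vs = ms @ vs ! b # ws"
    proof -
      have "drop (b - a - 1) (drop (Suc a) vs) = drop b vs" using ab by simp
      also have "\<dots> = vs ! b # ws" using ab by (simp add: ws_def Cons_nth_drop_Suc)
      finally show ?thesis unfolding ms_def by (metis append_take_drop_id)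
    qed
    have vs: "vs = us @ vs ! a # ms @ vs ! b # ws"
      using ab tail by (metis append_take_drop_id Cons_nth_drop_Suc us_def less_trans)
    have "omit a vs = us @ ms @ vs ! a # ws" using tail ab by (simp add: omit_def us_def)
    moreover have "omit b vs = us @ vs ! a # ms @ ws"
    proof -
      have "take b vs = us @ vs ! a # ms"
      proof -
        have "length (us @ vs ! a # ms) = b" using ab ms by (simp add: us_def)
        then show ?thesis using vs by (metis append.assoc append_Cons append_eq_conv_conj)
      qed
      then show ?thesis by (simp add: omit_def ws_def)
    qed
    ultimately have "\<alpha> (omit b vs) = (- 1) ^ (b - a - 1) * \<alpha> (omit a vs)"
      using conj_alt_move[OF \<alpha>, of us "vs ! a" ms ws] ms by simp
    moreover have "(- 1) ^ b = (- 1 :: complex) ^ a * (- 1) ^ (b - a - 1) * (- 1)"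
    proof -
      have "b = a + (b - a - 1) + 1" using ab by simp
      then show ?thesis by (metis power_add power_one_right)
    qed
    moreover have "(- 1 :: complex) ^ k * (- 1) ^ k = 1" for k
      by (simp add: power_mult_distrib[symmetric])
    ultimately show ?thesis using ab by (simp add: algebra_simps)
  qed
  finally show "wedge \<beta> \<alpha> vs = 0" by (simp add: wedge_def)
qed

text \<open>Removing entry i and then entry j < i leaves the same list as removing j and then i - 1.
  The map (i, j) to (j, i - 1) carries the index pairs below the diagonal bijectively to those on or
  above it, and paired terms cancel.\<close>

lemma sum_antisymmetric_omit:
  fixes T :: "nat \<Rightarrow> nat \<Rightarrow> 'b::ab_group_add"
  assumes "\<And>i j. j < i \<Longrightarrow> i < m \<Longrightarrow> T i j = - T j (i - 1)"
  shows "(\<Sum>i<m. \<Sum>j<m - 1. T i j) = 0"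
proof -
  let ?A = "{(i, j). i < m \<and> j < m - 1 \<and> j < i}" and ?B = "{(i, j). i < m \<and> j < m - 1 \<and> i \<le> j}"
  have fin: "finite ?A" "finite ?B"
    by (rule finite_subset[of _ "{..<m} \<times> {..<m - 1}"], auto)+
  have "(\<Sum>(i, j)\<in>?A. T i j) = (\<Sum>(i, j)\<in>?B. - T i j)"
    by (rule sum.reindex_bij_witness[of _ "\<lambda>(i, j). (Suc j, i)" "\<lambda>(i, j). (j, i - 1)"])
      (auto simp: assms)
  moreover have "(\<Sum>i<m. \<Sum>j<m - 1. T i j) = (\<Sum>(i, j)\<in>?A \<union> ?B. T i j)"
    unfolding sum.cartesian_product by (rule sum.cong) auto
  moreover have "(\<Sum>(i, j)\<in>?A \<union> ?B. T i j) = (\<Sum>(i, j)\<in>?A. T i j) + (\<Sum>(i, j)\<in>?B. T i j)"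
    by (rule sum.union_disjoint[OF fin]) auto
  ultimately show ?thesis by (simp add: split_def sum_negf)
qed

section \<open>The Dolbeault operator on forms\<close>

definition smooth_fun :: "('a::topological_space, 'n::finite) chart set \<Rightarrow> 'a set \<Rightarrow> ('a \<Rightarrow> complex) \<Rightarrow> bool" where
  "smooth_fun A V \<theta> \<longleftrightarrow> (\<forall>c\<in>A. smooth_on (snd c ` (V \<inter> fst c)) (\<lambda>z. \<theta> (chart_inv c z)))"

definition scale_form :: "('a \<Rightarrow> complex) \<Rightarrow> ('a, 'n) form \<Rightarrow> ('a, 'n) form" where
  "scale_form \<theta> \<omega> = (\<lambda>x c vs. \<theta> x * \<omega> x c vs)"

lemma form_restrict_apply: "x \<in> V \<Longrightarrow> form_restrict V \<omega> x = \<omega> x"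
  and form_restrict_outside: "x \<notin> V \<Longrightarrow> form_restrict V \<omega> x = 0"
  by (simp_all add: form_restrict_def)

lemma form_restrict_restrict: "V' \<subseteq> V \<Longrightarrow> form_restrict V' (form_restrict V \<omega>) = form_restrict V' \<omega>"
  by (rule ext) (auto simp: form_restrict_def)

lemma form_restrict_0: "form_restrict V 0 = 0"
  by (auto simp: form_restrict_def)

lemma form_restrict_diff: "form_restrict V (\<omega> - \<eta>) = form_restrict V \<omega> - form_restrict V \<eta>"
  by (auto simp: form_restrict_def)

lemma forms_eq_0: "\<omega> \<in> forms A q V \<Longrightarrow> \<not> (c \<in> A \<and> x \<in> V \<inter> fst c) \<Longrightarrow> \<omega> x c = 0"
  unfolding forms_def by blast

lemma forms_outside: "\<omega> \<in> forms A q V \<Longrightarrow> x \<notin> V \<Longrightarrow> \<omega> x = 0"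
  using forms_eq_0 by (fastforce simp: zero_fun_def)

lemma forms_conj_alt: "\<omega> \<in> forms A q V \<Longrightarrow> c \<in> A \<Longrightarrow> x \<in> V \<Longrightarrow> x \<in> fst c \<Longrightarrow> conj_alt q (\<omega> x c)"
  unfolding forms_def by blast

lemma forms_smooth:
  "\<omega> \<in> forms A q V \<Longrightarrow> c \<in> A \<Longrightarrow> smooth_on (snd c ` (V \<inter> fst c)) (\<lambda>z. \<omega> (chart_inv c z) c vs)"
  unfolding forms_def by blast

lemma forms_transition:
  "\<omega> \<in> forms A q V \<Longrightarrow> c \<in> A \<Longrightarrow> d \<in> A \<Longrightarrow> x \<in> V \<Longrightarrow> x \<in> fst c \<Longrightarrow> x \<in> fst d \<Longrightarrow>
    \<omega> x c vs = \<omega> x d (map (transition_deriv c d x) vs)"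
  unfolding forms_def by blast

lemma formsI:
  assumes "\<And>x c. \<not> (c \<in> A \<and> x \<in> V \<inter> fst c) \<Longrightarrow> \<omega> x c = 0"
    and "\<And>c x. c \<in> A \<Longrightarrow> x \<in> V \<Longrightarrow> x \<in> fst c \<Longrightarrow> conj_alt q (\<omega> x c)"
    and "\<And>c vs. c \<in> A \<Longrightarrow> smooth_on (snd c ` (V \<inter> fst c)) (\<lambda>z. \<omega> (chart_inv c z) c vs)"
    and "\<And>c d x vs. c \<in> A \<Longrightarrow> d \<in> A \<Longrightarrow> x \<in> V \<Longrightarrow> x \<in> fst c \<Longrightarrow> x \<in> fst d \<Longrightarrow>
      \<omega> x c vs = \<omega> x d (map (transition_deriv c d x) vs)"
  shows "\<omega> \<in> forms A q V"
  unfolding forms_def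
proof (intro CollectI conjI allI impI ballI)
  show "\<omega> x c = 0" if "\<not> (c \<in> A \<and> x \<in> V \<inter> fst c)" for x c by (rule assms(1)[OF that])
  show "conj_alt q (\<omega> x c)" if "c \<in> A" "x \<in> V \<inter> fst c" for x c using assms(2)[of c x] that by simp
  show "smooth_on (snd c ` (V \<inter> fst c)) (\<lambda>z. \<omega> (chart_inv c z) c vs)" if "c \<in> A" for c vs
    by (rule assms(3)[OF that])
  show "\<omega> x c vs = \<omega> x d (map (transition_deriv c d x) vs)"
    if "c \<in> A" "d \<in> A" "x \<in> V \<inter> fst c \<inter> fst d" for c d x vs
    using assms(4)[of c d x vs] that by simp
qed

lemma dbar_eq:
  "c \<in> A \<Longrightarrow> x \<in> V \<Longrightarrow> x \<in> fst c \<Longrightarrow> dbar A V \<omega> x c vs =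
    (\<Sum>i<length vs. (- 1) ^ i * dbar_dir (\<lambda>z. \<omega> (chart_inv c z) c (omit i vs)) (snd c x) (vs ! i))"
  by (simp add: dbar_def omit_def)

lemma dbar_eq_0: "\<not> (c \<in> A \<and> x \<in> V \<inter> fst c) \<Longrightarrow> dbar A V \<omega> x c = 0"
  by (auto simp: dbar_def zero_fun_def)

lemma conj_alt_0: "conj_alt q 0"
  by (simp add: conj_alt_def)

lemma conj_alt_combine:
  assumes "conj_alt q \<alpha>" "conj_alt q \<beta>"
  shows "conj_alt q (\<lambda>vs. a * \<alpha> vs + b * \<beta> vs)"
  unfolding conj_alt_def
proof (intro conjI allI impI)
  fix vs :: "(complex^'a) list" and i a' v w assume i: "i < length vs"
  show "a * \<alpha> (vs[i := a' *s v + w]) + b * \<beta> (vs[i := a' *s v + w]) =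
    cnj a' * (a * \<alpha> (vs[i := v]) + b * \<beta> (vs[i := v])) + (a * \<alpha> (vs[i := w]) + b * \<beta> (vs[i := w]))"
    unfolding conj_alt_linear[OF assms(1) i] conj_alt_linear[OF assms(2) i] by (simp add: algebra_simps)
next
  fix vs :: "(complex^'a) list" and i j assume ij: "i < j \<and> j < length vs \<and> vs ! i = vs ! j"
  then have "\<alpha> vs = 0" by (intro conj_alt_repeated[OF assms(1), of i j]) auto
  moreover have "\<beta> vs = 0" using ij by (intro conj_alt_repeated[OF assms(2), of i j]) auto
  ultimately show "a * \<alpha> vs + b * \<beta> vs = 0" by simp
qed (simp add: conj_alt_length[OF assms(1)] conj_alt_length[OF assms(2)])

section \<open>Forms and their operations for a fixed complex atlas\<close>

locale holomorphic_atlas =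
  fixes A :: "('a::topological_space, 'n::finite) chart set"
  assumes atlas: "complex_atlas A"
begin

lemma chart_homeomorphism: "c \<in> A \<Longrightarrow> homeomorphism (fst c) (snd c ` fst c) (snd c) (chart_inv c)"
  using atlas unfolding complex_atlas_def by blast

lemma open_chart: "c \<in> A \<Longrightarrow> open (fst c)"
  using atlas unfolding complex_atlas_def by blast

lemma chart_inv_chart: "c \<in> A \<Longrightarrow> x \<in> fst c \<Longrightarrow> chart_inv c (snd c x) = x"
  using chart_homeomorphism homeomorphism_apply1 by metis

lemma chart_cover: obtains c where "c \<in> A" "x \<in> fst c"
  using atlas unfolding complex_atlas_def by blast

lemma open_chart_image:
  assumes "c \<in> A" "open V"
  shows "open (snd c ` (V \<inter> fst c))"
proof -
  have "openin (top_of_set (fst c)) (V \<inter> fst c)"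
    using assms(2) by (metis Int_commute openin_open_Int)
  then have "openin (top_of_set (snd c ` fst c)) (snd c ` (V \<inter> fst c))"
    by (rule homeomorphism_imp_open_map[OF chart_homeomorphism[OF assms(1)]])
  moreover have "open (snd c ` fst c)" using atlas assms(1) unfolding complex_atlas_def by blast
  ultimately show ?thesis using openin_open_trans by blast
qed

lemma transition_smooth:
  "c \<in> A \<Longrightarrow> d \<in> A \<Longrightarrow> smooth_on (snd c ` (fst c \<inter> fst d)) (transition c d)"
  using atlas unfolding complex_atlas_def holo_map_on_def by blast

lemma transition_has_derivative:
  assumes "c \<in> A" "d \<in> A" "x \<in> fst c" "x \<in> fst d"
  shows "(transition c d has_derivative transition_deriv c d x) (at (snd c x))"
  unfolding transition_deriv_def
  by (rule smooth_on_has_derivative[OF transition_smooth[OF assms(1,2)]]) (use assms in auto)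

lemma transition_deriv_scale:
  assumes "c \<in> A" "d \<in> A" "x \<in> fst c" "x \<in> fst d"
  shows "transition_deriv c d x (a *s v) = a *s transition_deriv c d x v"
proof -
  have "holo_map_on (snd c ` (fst c \<inter> fst d)) (transition c d)"
    using atlas assms unfolding complex_atlas_def by blast
  then show ?thesis using assms unfolding transition_deriv_def holo_map_on_def by blast
qed

lemma transition_chart: "c \<in> A \<Longrightarrow> x \<in> fst c \<Longrightarrow> transition c d (snd c x) = snd d x"
  by (simp add: transition_def chart_inv_chart)

text \<open>Transition maps are smooth, so smoothness in the one chart that contains V is enough. It
  lets a cut-off constructed in C^n act on forms.\<close>

lemma smooth_fun_of_chart:
  assumes c: "c \<in> A" and V: "open V" "V \<subseteq> fst c" and \<theta>: "smooth_on (snd c ` V) \<theta>"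
  shows "smooth_fun A V (\<lambda>x. \<theta> (snd c x))"
  unfolding smooth_fun_def
proof
  fix d assume d: "d \<in> A"
  have "smooth_on (snd d ` (V \<inter> fst d)) (\<lambda>z. \<theta> (transition d c z))"
  proof (rule smooth_on_compose[OF open_chart_image[OF d V(1)] _ \<theta>])
    show "smooth_on (snd d ` (V \<inter> fst d)) (transition d c)"
      by (rule smooth_on_subset[OF transition_smooth[OF d c]]) (use V in auto)
    show "transition d c ` snd d ` (V \<inter> fst d) \<subseteq> snd c ` V"
      using V(2) by (auto simp: transition_chart[OF d])
  qed
  then show "smooth_on (snd d ` (V \<inter> fst d)) (\<lambda>z. \<theta> (snd c (chart_inv d z)))"
    by (simp add: transition_def)
qed

lemma forms_0: "0 \<in> forms A q V"
  by (rule formsI) (auto simp: conj_alt_0 smooth_on_const)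

lemma forms_diff:
  assumes "open V" "\<omega> \<in> forms A q V" "\<eta> \<in> forms A q V"
  shows "\<omega> - \<eta> \<in> forms A q V"
proof (rule formsI)
  show "(\<omega> - \<eta>) x c = 0" if "\<not> (c \<in> A \<and> x \<in> V \<inter> fst c)" for x c
    using forms_eq_0[OF assms(2) that] forms_eq_0[OF assms(3) that] by simp
  show "conj_alt q ((\<omega> - \<eta>) x c)" if "c \<in> A" "x \<in> V" "x \<in> fst c" for c x
    using conj_alt_combine[OF forms_conj_alt[OF assms(2) that] forms_conj_alt[OF assms(3) that], of 1 "-1"]
    by (simp add: fun_diff_def)
  show "smooth_on (snd c ` (V \<inter> fst c)) (\<lambda>z. (\<omega> - \<eta>) (chart_inv c z) c vs)" if "c \<in> A" for c vs
    using smooth_on_diff[OF open_chart_image[OF that assms(1)] forms_smooth[OF assms(2) that]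
        forms_smooth[OF assms(3) that]] by simp
  show "(\<omega> - \<eta>) x c vs = (\<omega> - \<eta>) x d (map (transition_deriv c d x) vs)"
    if "c \<in> A" "d \<in> A" "x \<in> V" "x \<in> fst c" "x \<in> fst d" for c d x vs
    using forms_transition[OF assms(2) that] forms_transition[OF assms(3) that] by simp
qed

text \<open>All conditions on a form are local. The use is extension by zero: a form that is zero
  near the edge of its domain is glued with the zero form.\<close>

lemma forms_glue:
  assumes "\<And>x. x \<notin> V \<Longrightarrow> \<omega> x = 0"
    and cover: "\<And>x. x \<in> V \<Longrightarrow> \<exists>N \<eta>. open N \<and> x \<in> N \<and> \<eta> \<in> forms A q N \<and> (\<forall>y\<in>N. \<omega> y = \<eta> y)"
  shows "\<omega> \<in> forms A q V"
proof (rule formsI)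
  show "\<omega> x c = 0" if "\<not> (c \<in> A \<and> x \<in> V \<inter> fst c)" for x c
  proof (cases "x \<in> V")
    case True
    then obtain N \<eta> where "\<eta> \<in> forms A q N" "\<omega> x = \<eta> x" using cover by blast
    then show ?thesis using forms_eq_0[of \<eta> A q N c x] True that by auto
  qed (simp add: assms(1))
  show "conj_alt q (\<omega> x c)" if x: "c \<in> A" "x \<in> V" "x \<in> fst c" for c x
  proof -
    obtain N \<eta> where "x \<in> N" "\<eta> \<in> forms A q N" "\<omega> x = \<eta> x" using cover[OF x(2)] by blast
    then show ?thesis using forms_conj_alt[of \<eta> A q N c x] x by simp
  qed
  show "smooth_on (snd c ` (V \<inter> fst c)) (\<lambda>z. \<omega> (chart_inv c z) c vs)" if c: "c \<in> A" for c vs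
  proof (rule smooth_on_local)
    fix z assume "z \<in> snd c ` (V \<inter> fst c)"
    then obtain x where x: "x \<in> V" "x \<in> fst c" "z = snd c x" by blast
    then obtain N \<eta> where N: "open N" "x \<in> N" "\<eta> \<in> forms A q N" "\<forall>y\<in>N. \<omega> y = \<eta> y"
      using cover by blast
    have op: "open (snd c ` (N \<inter> fst c))" by (rule open_chart_image[OF c N(1)])
    have "\<omega> (chart_inv c z) c vs = \<eta> (chart_inv c z) c vs" if "z \<in> snd c ` (N \<inter> fst c)" for z
      using that N(4) by (auto simp: chart_inv_chart[OF c])
    then have "smooth_on (snd c ` (N \<inter> fst c)) (\<lambda>z. \<omega> (chart_inv c z) c vs)"
      by (rule smooth_on_cong_imp[OF op forms_smooth[OF N(3) c]])
    then show "\<exists>T. open T \<and> z \<in> T \<and> smooth_on T (\<lambda>z. \<omega> (chart_inv c z) c vs)"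
      using op x N(2) by blast
  qed
  show "\<omega> x c vs = \<omega> x d (map (transition_deriv c d x) vs)"
    if x: "c \<in> A" "d \<in> A" "x \<in> V" "x \<in> fst c" "x \<in> fst d" for c d x vs
  proof -
    obtain N \<eta> where "x \<in> N" "\<eta> \<in> forms A q N" "\<omega> x = \<eta> x" using cover[OF x(3)] by blast
    then show ?thesis using forms_transition[of \<eta> A q N c d x vs] x by simp
  qed
qed

lemma forms_restrict:
  assumes "open V'" "V' \<subseteq> V" "\<omega> \<in> forms A q V"
  shows "form_restrict V' \<omega> \<in> forms A q V'"
proof (rule formsI)
  show "form_restrict V' \<omega> x c = 0" if "\<not> (c \<in> A \<and> x \<in> V' \<inter> fst c)" for x c
    using forms_eq_0[OF assms(3), of c x] assms(2) that by (auto simp: form_restrict_def)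
  show "conj_alt q (form_restrict V' \<omega> x c)" if "c \<in> A" "x \<in> V'" "x \<in> fst c" for c x
    using forms_conj_alt[OF assms(3) that(1) subsetD[OF assms(2) that(2)] that(3)] that(2)
    by (simp add: form_restrict_apply)
  show "smooth_on (snd c ` (V' \<inter> fst c)) (\<lambda>z. form_restrict V' \<omega> (chart_inv c z) c vs)" if c: "c \<in> A" for c vs
  proof -
    have *: "form_restrict V' \<omega> (chart_inv c z) c vs = \<omega> (chart_inv c z) c vs" if "z \<in> snd c ` (V' \<inter> fst c)" for z
      using that by (auto simp: chart_inv_chart[OF c] form_restrict_apply)
    have "smooth_on (snd c ` (V' \<inter> fst c)) (\<lambda>z. \<omega> (chart_inv c z) c vs)"
      by (rule smooth_on_subset[OF forms_smooth[OF assms(3) c]]) (use assms(2) in blast)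
    then show ?thesis using * by (rule smooth_on_cong_imp[OF open_chart_image[OF c assms(1)]])
  qed
  show "form_restrict V' \<omega> x c vs = form_restrict V' \<omega> x d (map (transition_deriv c d x) vs)"
    if "c \<in> A" "d \<in> A" "x \<in> V'" "x \<in> fst c" "x \<in> fst d" for c d x vs
    using forms_transition[OF assms(3) that(1,2) subsetD[OF assms(2) that(3)] that(4,5)] that(3)
    by (simp add: form_restrict_apply)
qed

lemma forms_differentiable:
  assumes "\<omega> \<in> forms A q V" "c \<in> A" "x \<in> V" "x \<in> fst c"
  shows "(\<lambda>z. \<omega> (chart_inv c z) c vs) differentiable at (snd c x)"
  by (rule smooth_on_differentiable[OF forms_smooth[OF assms(1,2)]]) (use assms in auto)

text \<open>dbar is a local operator; the domains V and V' only decide where the value is set to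
  zero by convention.\<close>

lemma dbar_cong:
  assumes "open N" "x \<in> N" "N \<subseteq> V" "N \<subseteq> V'" "\<And>y. y \<in> N \<Longrightarrow> \<omega> y = \<eta> y"
  shows "dbar A V \<omega> x = dbar A V' \<eta> x"
proof (intro ext)
  fix c vs
  show "dbar A V \<omega> x c vs = dbar A V' \<eta> x c vs"
  proof (cases "c \<in> A \<and> x \<in> fst c")
    case True
    then have c: "c \<in> A" "x \<in> fst c" by auto
    have "dbar_dir (\<lambda>z. \<omega> (chart_inv c z) c us) (snd c x) = dbar_dir (\<lambda>z. \<eta> (chart_inv c z) c us) (snd c x)" for us
    proof (rule dbar_dir_cong[OF open_chart_image[OF c(1) assms(1)]])
      show "snd c x \<in> snd c ` (N \<inter> fst c)" using c assms(2) by blast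
      show "\<omega> (chart_inv c z) c us = \<eta> (chart_inv c z) c us" if "z \<in> snd c ` (N \<inter> fst c)" for z
        using that assms(5) by (auto simp: chart_inv_chart[OF c(1)])
    qed
    moreover have "x \<in> V" "x \<in> V'" using assms by auto
    ultimately show ?thesis using c by (simp add: dbar_eq)
  next
    case False
    then show ?thesis by (auto simp: dbar_def)
  qed
qed

lemma dbar_outside: "x \<notin> V \<Longrightarrow> dbar A V \<omega> x = 0"
  by (auto simp: dbar_def zero_fun_def)

lemma dbar_restrict:
  assumes "open V'" "V' \<subseteq> V"
  shows "dbar A V' (form_restrict V' \<omega>) = form_restrict V' (dbar A V \<omega>)"
proof
  fix x
  show "dbar A V' (form_restrict V' \<omega>) x = form_restrict V' (dbar A V \<omega>) x"
  proof (cases "x \<in> V'")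
    case True
    then show ?thesis
      using dbar_cong[OF assms(1) True order_refl assms(2), of "form_restrict V' \<omega>" \<omega>]
      by (simp add: form_restrict_apply)
  qed (simp add: form_restrict_outside dbar_outside)
qed

lemma dbar_0: "dbar A V 0 = 0"
  by (intro ext) (simp add: dbar_def zero_fun_def dbar_dir_const)

lemma dbar_diff:
  assumes "\<omega> \<in> forms A q V" "\<eta> \<in> forms A q V"
  shows "dbar A V (\<omega> - \<eta>) = dbar A V \<omega> - dbar A V \<eta>"
proof (intro ext)
  fix x c vs
  show "dbar A V (\<omega> - \<eta>) x c vs = (dbar A V \<omega> - dbar A V \<eta>) x c vs"
  proof (cases "c \<in> A \<and> x \<in> V \<inter> fst c")
    case True
    then have c: "c \<in> A" "x \<in> V" "x \<in> fst c" by auto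
    show ?thesis
      by (simp add: dbar_eq[OF c] dbar_dir_diff forms_differentiable[OF assms(1) c]
          forms_differentiable[OF assms(2) c] right_diff_distrib sum_subtractf)
  qed (simp add: dbar_eq_0)
qed

lemma scale_form_mem:
  assumes "open V" "smooth_fun A V \<theta>" "\<omega> \<in> forms A q V"
  shows "scale_form \<theta> \<omega> \<in> forms A q V"
proof (rule formsI)
  show "scale_form \<theta> \<omega> x c = 0" if "\<not> (c \<in> A \<and> x \<in> V \<inter> fst c)" for x c
    using forms_eq_0[OF assms(3) that] by (auto simp: scale_form_def)
  show "conj_alt q (scale_form \<theta> \<omega> x c)" if "c \<in> A" "x \<in> V" "x \<in> fst c" for c x
    using conj_alt_combine[OF forms_conj_alt[OF assms(3) that] conj_alt_0, of "\<theta> x"]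
    by (simp add: scale_form_def)
  show "smooth_on (snd c ` (V \<inter> fst c)) (\<lambda>z. scale_form \<theta> \<omega> (chart_inv c z) c vs)" if "c \<in> A" for c vs
    unfolding scale_form_def using assms(2) that
    by (intro smooth_on_mult[OF open_chart_image[OF that assms(1)] _ forms_smooth[OF assms(3) that]])
      (simp add: smooth_fun_def)
  show "scale_form \<theta> \<omega> x c vs = scale_form \<theta> \<omega> x d (map (transition_deriv c d x) vs)"
    if "c \<in> A" "d \<in> A" "x \<in> V" "x \<in> fst c" "x \<in> fst d" for c d x vs
    using forms_transition[OF assms(3) that, of vs] by (simp add: scale_form_def)
qed

lemma smooth_fun_differentiable:
  assumes "smooth_fun A V \<theta>" "c \<in> A" "x \<in> V" "x \<in> fst c"
  shows "(\<lambda>z. \<theta> (chart_inv c z)) differentiable at (snd c x)"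
  by (rule smooth_on_differentiable[of "snd c ` (V \<inter> fst c)"]) (use assms in \<open>auto simp: smooth_fun_def\<close>)

lemma dbar_scale_form:
  assumes "smooth_fun A V \<theta>" "\<omega> \<in> forms A q V" "c \<in> A" "x \<in> V" "x \<in> fst c"
  shows "dbar A V (scale_form \<theta> \<omega>) x c vs = \<theta> x * dbar A V \<omega> x c vs
    + wedge (dbar_dir (\<lambda>z. \<theta> (chart_inv c z)) (snd c x)) (\<omega> x c) vs"
  by (simp add: dbar_eq[OF assms(3-5)] scale_form_def wedge_def dbar_dir_mult
      smooth_fun_differentiable[OF assms(1,3-5)] forms_differentiable[OF assms(2-5)]
      chart_inv_chart[OF assms(3,5)] sum.distrib sum_distrib_left algebra_simps)

text \<open>The chain rule with a holomorphic transition map; it says that dbar \<theta> is a well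
  defined form of type (0,1).\<close>

lemma dbar_dir_transition:
  assumes "smooth_fun A V \<theta>" "open V" and x: "c \<in> A" "d \<in> A" "x \<in> V" "x \<in> fst c" "x \<in> fst d"
  shows "dbar_dir (\<lambda>z. \<theta> (chart_inv c z)) (snd c x) v =
    dbar_dir (\<lambda>z. \<theta> (chart_inv d z)) (snd d x) (transition_deriv c d x v)"
proof -
  have "dbar_dir (\<lambda>z. \<theta> (chart_inv c z)) (snd c x) v =
      dbar_dir (\<lambda>z. \<theta> (chart_inv d (transition c d z))) (snd c x) v"
  proof (rule fun_cong[OF dbar_dir_cong], rule open_chart_image[OF x(1) open_chart[OF x(2)]])
    show "snd c x \<in> snd c ` (fst d \<inter> fst c)" using x by blast
    show "\<theta> (chart_inv c z) = \<theta> (chart_inv d (transition c d z))" if "z \<in> snd c ` (fst d \<inter> fst c)" for z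
      using that x by (auto simp: transition_def chart_inv_chart)
  qed
  also have "dbar_dir (\<lambda>z. \<theta> (chart_inv d (transition c d z))) (snd c x) v =
      dbar_dir (\<lambda>z. \<theta> (chart_inv d z)) (transition c d (snd c x)) (transition_deriv c d x v)"
    by (rule dbar_dir_compose_holo[OF transition_has_derivative[OF x(1,2,4,5)]])
      (use smooth_fun_differentiable[OF assms(1) x(2,3,5)] transition_deriv_scale[OF x(1,2,4,5)]
        transition_chart[OF x(1,4)] in simp_all)
  finally show ?thesis using transition_chart[OF x(1,4)] by simp
qed

lemma wedge_map: "wedge \<beta> \<alpha> (map L vs) = wedge (\<lambda>v. \<beta> (L v)) (\<lambda>vs. \<alpha> (map L vs)) vs"
  by (simp add: wedge_def map_omit)

text \<open>By the Leibniz rule no second derivatives of transition maps are needed here.\<close>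

lemma dbar_scale_form_mem:
  assumes "open V" and \<theta>: "smooth_fun A V \<theta>" and \<omega>: "\<omega> \<in> forms A q V"
    and d\<omega>: "dbar A V \<omega> \<in> forms A (q + 1) V"
  shows "dbar A V (scale_form \<theta> \<omega>) \<in> forms A (q + 1) V"
proof (rule formsI)
  show "dbar A V (scale_form \<theta> \<omega>) x c = 0" if "\<not> (c \<in> A \<and> x \<in> V \<inter> fst c)" for x c
    by (rule dbar_eq_0[OF that])
  show "conj_alt (q + 1) (dbar A V (scale_form \<theta> \<omega>) x c)" if c: "c \<in> A" "x \<in> V" "x \<in> fst c" for c x
  proof -
    have "conj_alt (q + 1) (wedge (dbar_dir (\<lambda>z. \<theta> (chart_inv c z)) (snd c x)) (\<omega> x c))"
      by (rule conj_alt_wedge[OF forms_conj_alt[OF \<omega> c]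
            dbar_dir_conj_linear[OF smooth_fun_differentiable[OF \<theta> c]]])
    then show ?thesis
      using conj_alt_combine[OF forms_conj_alt[OF d\<omega> c], of _ "\<theta> x" 1]
      by (simp add: dbar_scale_form[OF \<theta> \<omega> c, abs_def])
  qed
  show "smooth_on (snd c ` (V \<inter> fst c)) (\<lambda>z. dbar A V (scale_form \<theta> \<omega>) (chart_inv c z) c vs)" if c: "c \<in> A" for c vs
  proof -
    let ?U = "snd c ` (V \<inter> fst c)"
    have U: "open ?U" by (rule open_chart_image[OF c assms(1)])
    have \<theta>c: "smooth_on ?U (\<lambda>z. \<theta> (chart_inv c z))" using \<theta> c by (simp add: smooth_fun_def)
    have "smooth_on ?U (\<lambda>z. \<theta> (chart_inv c z) * dbar A V \<omega> (chart_inv c z) c vs +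
        (\<Sum>i<length vs. (- 1) ^ i * (dbar_dir (\<lambda>z. \<theta> (chart_inv c z)) z (vs ! i) * \<omega> (chart_inv c z) c (omit i vs))))"
      by (intro smooth_on_add smooth_on_sum smooth_on_mult smooth_on_const smooth_on_dbar_dir U \<theta>c
          forms_smooth[OF \<omega> c] forms_smooth[OF d\<omega> c])
    moreover have "dbar A V (scale_form \<theta> \<omega>) (chart_inv c z) c vs = \<theta> (chart_inv c z) * dbar A V \<omega> (chart_inv c z) c vs +
        (\<Sum>i<length vs. (- 1) ^ i * (dbar_dir (\<lambda>z. \<theta> (chart_inv c z)) z (vs ! i) * \<omega> (chart_inv c z) c (omit i vs)))"
      if "z \<in> ?U" for z
      using that by (auto simp: dbar_scale_form[OF \<theta> \<omega> c] chart_inv_chart[OF c] wedge_def)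
    ultimately show ?thesis by (rule smooth_on_cong_imp[OF U])
  qed
  show "dbar A V (scale_form \<theta> \<omega>) x c vs = dbar A V (scale_form \<theta> \<omega>) x d (map (transition_deriv c d x) vs)"
    if x: "c \<in> A" "d \<in> A" "x \<in> V" "x \<in> fst c" "x \<in> fst d" for c d x vs
  proof -
    have \<omega>x: "\<omega> x c us = \<omega> x d (map (transition_deriv c d x) us)" for us
      by (rule forms_transition[OF \<omega> x])
    show ?thesis
      unfolding dbar_scale_form[OF \<theta> \<omega> x(1,3,4)] dbar_scale_form[OF \<theta> \<omega> x(2,3,5)] wedge_map
        forms_transition[OF d\<omega> x, of vs]
      by (simp add: wedge_def dbar_dir_transition[OF \<theta> assms(1) x] \<omega>x)
  qed
qed

text \<open>In one chart this is a double sum over the first omitted index i and the second omitted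
  index j. Commuting dbar derivatives and the simplicial identity match the terms, and the shift
  from i to i - 1 makes the signs opposite.\<close>

lemma dbar_dbar:
  assumes "open V" "\<omega> \<in> forms A q V"
  shows "dbar A V (dbar A V \<omega>) = 0"
proof (intro ext)
  fix x c vs
  show "dbar A V (dbar A V \<omega>) x c vs = 0 x c vs"
  proof (cases "c \<in> A \<and> x \<in> V \<inter> fst c")
    case True
    then have c: "c \<in> A" "x \<in> V" "x \<in> fst c" by auto
    let ?U = "snd c ` (V \<inter> fst c)" and ?z = "snd c x"
    have U: "open ?U" by (rule open_chart_image[OF c(1) assms(1)])
    have z: "?z \<in> ?U" using c by blast
    define F where "F us z = \<omega> (chart_inv c z) c us" for us z
    have F: "smooth_on ?U (F us)" for us
      unfolding F_def by (rule forms_smooth[OF assms(2) c(1)])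
    have diff: "(\<lambda>z. dbar_dir (F us) z v) differentiable at ?z" for us v
      by (rule smooth_on_differentiable[OF smooth_on_dbar_dir[OF U F] z])
    define T where "T i j = (- 1) ^ i * ((- 1) ^ j *
        dbar_dir (\<lambda>z. dbar_dir (F (omit j (omit i vs))) z (omit i vs ! j)) ?z (vs ! i))" for i j
    have inner: "dbar_dir (\<lambda>z. dbar A V \<omega> (chart_inv c z) c us) ?z v =
        (\<Sum>j<length us. (- 1) ^ j * dbar_dir (\<lambda>z. dbar_dir (F (omit j us)) z (us ! j)) ?z v)" for us v
    proof -
      have "dbar_dir (\<lambda>z. dbar A V \<omega> (chart_inv c z) c us) ?z =
          dbar_dir (\<lambda>z. \<Sum>j<length us. (- 1) ^ j * dbar_dir (F (omit j us)) z (us ! j)) ?z"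
        by (rule dbar_dir_cong[OF U z])
          (use c(1) in \<open>auto simp: dbar_eq F_def[abs_def] chart_inv_chart\<close>)
      then show ?thesis
        using diff by (simp add: dbar_dir_sum dbar_dir_cmult)
    qed
    have "dbar A V (dbar A V \<omega>) x c vs = (\<Sum>i<length vs. \<Sum>j<length vs - 1. T i j)"
      by (simp add: dbar_eq[OF c, of "dbar A V \<omega>"] inner length_omit T_def sum_distrib_left)
    also have "\<dots> = 0"
    proof (rule sum_antisymmetric_omit)
      fix i j assume ij: "j < i" "i < length vs"
      have "(- 1 :: complex) ^ i = - ((- 1) ^ (i - 1))" using ij by (cases i) auto
      moreover have "omit i vs ! j = vs ! j" "omit j vs ! (i - 1) = vs ! i"
        using ij by (auto simp: nth_omit)
      ultimately show "T i j = - T j (i - 1)"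
        unfolding T_def omit_omit[OF ij, symmetric]
        using dbar_dir_commute[OF U F z, of "omit j (omit i vs)" "vs ! j" "vs ! i"] by simp
    qed
    finally show ?thesis by simp
  qed (simp add: dbar_eq_0)
qed

end

section \<open>Relative Dolbeault cohomology and its direct limits\<close>

text \<open>Openness of V - S is asked instead of closedness of S because a tube is closed relative
  to W only.\<close>

definition open_pair :: "'a::topological_space pair \<Rightarrow> bool" where
  "open_pair = (\<lambda>(V, S). open V \<and> open (V - S))"

definition directed_pairs :: "'a::topological_space pair set \<Rightarrow> bool" where
  "directed_pairs I \<longleftrightarrow> (\<forall>P\<in>I. open_pair P) \<and> (\<forall>P\<in>I. \<forall>Q\<in>I. \<exists>R\<in>I. finer P R \<and> finer Q R)"

lemma directed_pairs_open: "directed_pairs I \<Longrightarrow> P \<in> I \<Longrightarrow> open_pair P"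
  by (simp add: directed_pairs_def)

lemma directed_pairs_finer:
  assumes "directed_pairs I" "P \<in> I" "Q \<in> I"
  obtains R where "R \<in> I" "finer P R" "finer Q R"
  using assms unfolding directed_pairs_def by blast

lemma finer_refl: "finer P P"
  by (auto simp: finer_def)

lemma finer_trans: "finer P Q \<Longrightarrow> finer Q R \<Longrightarrow> finer P R"
  by (auto simp: finer_def)

lemma cochain_restrict_restrict:
  "finer Q R \<Longrightarrow> cochain_restrict R (cochain_restrict Q \<sigma>) = cochain_restrict R \<sigma>"
  by (cases Q, cases R, cases \<sigma>)
    (auto simp: cochain_restrict_def finer_def intro!: form_restrict_restrict)

lemma cochain_restrict_diff:
  "cochain_restrict Q (\<sigma> - \<tau>) = cochain_restrict Q \<sigma> - cochain_restrict Q \<tau>"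
  by (cases Q, cases \<sigma>, cases \<tau>) (simp add: cochain_restrict_def form_restrict_diff)

lemma cochain_restrict_0: "cochain_restrict Q 0 = 0"
  by (cases Q) (simp add: cochain_restrict_def form_restrict_0 zero_prod_def)

context holomorphic_atlas
begin

lemma cochains_0: "0 \<in> cochains A q P"
  by (cases P) (simp add: cochains_def forms_0 zero_prod_def)

lemma cochains_diff:
  "open_pair P \<Longrightarrow> \<sigma> \<in> cochains A q P \<Longrightarrow> \<tau> \<in> cochains A q P \<Longrightarrow> \<sigma> - \<tau> \<in> cochains A q P"
  by (cases P) (auto simp: cochains_def open_pair_def intro!: forms_diff)

lemma vartheta_0: "vartheta A P 0 = 0"
  by (cases P) (simp add: vartheta_def dbar_0 form_restrict_0 zero_prod_def)

text \<open>Membership in the cochains supplies differentiability; without it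
  \<open>frechet_derivative\<close> is an arbitrary choice and additivity may fail.\<close>

lemma vartheta_diff:
  assumes "\<sigma> \<in> cochains A q P" "\<tau> \<in> cochains A q P"
  shows "vartheta A P (\<sigma> - \<tau>) = vartheta A P \<sigma> - vartheta A P \<tau>"
  using assms
  by (cases P) (auto simp: cochains_def vartheta_def form_restrict_diff dbar_diff)

lemma cochains_restrict:
  "finer P Q \<Longrightarrow> open_pair Q \<Longrightarrow> \<sigma> \<in> cochains A q P \<Longrightarrow> cochain_restrict Q \<sigma> \<in> cochains A q Q"
  by (cases P, cases Q, cases \<sigma>)
    (auto simp: cochains_def cochain_restrict_def finer_def open_pair_def intro: forms_restrict[rotated 2])

lemma vartheta_restrict:
  assumes "finer P Q" "open_pair Q"
  shows "vartheta A Q (cochain_restrict Q \<sigma>) = cochain_restrict Q (vartheta A P \<sigma>)"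
proof -
  obtain V S V' S' \<sigma>1 \<sigma>01 where eq: "P = (V, S)" "Q = (V', S')" "\<sigma> = (\<sigma>1, \<sigma>01)"
    by (cases P, cases Q, cases \<sigma>) auto
  have sub: "V' \<subseteq> V" "V' - S' \<subseteq> V - S" "V' - S' \<subseteq> V'" and op: "open V'" "open (V' - S')"
    using assms unfolding eq by (auto simp: finer_def open_pair_def)
  show ?thesis
    unfolding eq
    by (simp add: vartheta_def cochain_restrict_def dbar_restrict[OF op(1) sub(1)]
        dbar_restrict[OF op(2) sub(2)] form_restrict_diff form_restrict_restrict[OF sub(2)]
        form_restrict_restrict[OF sub(3)])
qed

lemma cocycles_iff: "\<sigma> \<in> cocycles A q P \<longleftrightarrow> \<sigma> \<in> cochains A q P \<and> vartheta A P \<sigma> = 0"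
  by (simp add: cocycles_def zero_prod_def)

lemma cocycles_0: "0 \<in> cocycles A q P"
  by (simp add: cocycles_iff cochains_0 vartheta_0)

lemma cocycles_restrict:
  "finer P Q \<Longrightarrow> open_pair Q \<Longrightarrow> \<sigma> \<in> cocycles A q P \<Longrightarrow> cochain_restrict Q \<sigma> \<in> cocycles A q Q"
  by (simp add: cocycles_iff cochains_restrict vartheta_restrict cochain_restrict_0)

lemma coboundaries_restrict:
  assumes "finer P Q" "open_pair Q" "\<sigma> \<in> coboundaries A q P"
  shows "cochain_restrict Q \<sigma> \<in> coboundaries A q Q"
proof -
  obtain \<rho> where "\<rho> \<in> cochains A (q - 1) P" "\<sigma> = vartheta A P \<rho>"
    using assms(3) by (auto simp: coboundaries_def)
  then have "cochain_restrict Q \<sigma> = vartheta A Q (cochain_restrict Q \<rho>)"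
      "cochain_restrict Q \<rho> \<in> cochains A (q - 1) Q"
    using vartheta_restrict[OF assms(1,2), of \<rho>] cochains_restrict[OF assms(1,2)] by auto
  then show ?thesis unfolding coboundaries_def by (rule image_eqI)
qed

lemma coboundaries_0: "0 \<in> coboundaries A q P"
  unfolding coboundaries_def using vartheta_0[of P] cochains_0 by (metis image_eqI)

lemma coboundaries_diff:
  assumes "open_pair P" "\<sigma> \<in> coboundaries A q P" "\<tau> \<in> coboundaries A q P"
  shows "\<sigma> - \<tau> \<in> coboundaries A q P"
proof -
  obtain \<rho> \<rho>' where \<rho>: "\<rho> \<in> cochains A (q - 1) P" "\<sigma> = vartheta A P \<rho>"
      "\<rho>' \<in> cochains A (q - 1) P" "\<tau> = vartheta A P \<rho>'"
    using assms(2,3) by (auto simp: coboundaries_def)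
  have "\<sigma> - \<tau> = vartheta A P (\<rho> - \<rho>')" by (simp add: \<rho> vartheta_diff[OF \<rho>(1,3)])
  then show ?thesis
    unfolding coboundaries_def using cochains_diff[OF assms(1) \<rho>(1,3)] by blast
qed

lemma coboundaries_minus:
  assumes "open_pair P" "\<sigma> - \<tau> \<in> coboundaries A q P"
  shows "\<tau> - \<sigma> \<in> coboundaries A q P"
  using coboundaries_diff[OF assms(1) coboundaries_0 assms(2)] by simp

section \<open>Cohomology classes and germs as quotients\<close>

lemma cohomologous_iff:
  "(\<sigma>, \<tau>) \<in> cohomologous A q P \<longleftrightarrow>
    \<sigma> \<in> cocycles A q P \<and> \<tau> \<in> cocycles A q P \<and> \<sigma> - \<tau> \<in> coboundaries A q P"
  by (simp add: cohomologous_def)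

lemma equiv_cohomologous:
  assumes "open_pair P"
  shows "equiv (cocycles A q P) (cohomologous A q P)"
proof (rule equivI)
  show "cohomologous A q P \<subseteq> cocycles A q P \<times> cocycles A q P"
    by (auto simp: cohomologous_iff)
  show "refl_on (cocycles A q P) (cohomologous A q P)"
    by (auto simp: refl_on_def cohomologous_iff coboundaries_0)
  show "sym (cohomologous A q P)"
    unfolding sym_def cohomologous_iff using coboundaries_minus[OF assms] by blast
  show "trans (cohomologous A q P)"
  proof (rule transI)
    fix \<sigma> \<tau> \<rho>
    assume *: "(\<sigma>, \<tau>) \<in> cohomologous A q P" "(\<tau>, \<rho>) \<in> cohomologous A q P"
    \<comment> \<open>The second relation is reversed so that \<sigma> - \<rho> becomes a difference
      of two coboundaries.\<close>
    then have "\<sigma> - \<tau> \<in> coboundaries A q P" "\<rho> - \<tau> \<in> coboundaries A q P"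
      unfolding cohomologous_iff using coboundaries_minus[OF assms] by blast+
    then have "(\<sigma> - \<tau>) - (\<rho> - \<tau>) \<in> coboundaries A q P"
      by (rule coboundaries_diff[OF assms])
    then show "(\<sigma>, \<rho>) \<in> cohomologous A q P" using * by (simp add: cohomologous_iff)
  qed
qed

lemma cohom_class_eq_iff:
  assumes "open_pair P" "\<sigma> \<in> cocycles A q P" "\<tau> \<in> cocycles A q P"
  shows "cohom_class A q P \<sigma> = cohom_class A q P \<tau> \<longleftrightarrow> \<sigma> - \<tau> \<in> coboundaries A q P"
  unfolding cohom_class_def eq_equiv_class_iff[OF equiv_cohomologous[OF assms(1)] assms(2,3)]
  using assms by (simp add: cohomologous_iff)

lemma cohomology_iff: "h \<in> cohomology A q P \<longleftrightarrow> (\<exists>\<sigma>\<in>cocycles A q P. h = cohom_class A q P \<sigma>)"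
  by (auto simp: cohomology_def quotient_def cohom_class_def)

text \<open>\<open>cohom_restrict\<close> is a union over all representatives. Coboundaries restrict
  to coboundaries, so all sets in this union coincide, and the union is not empty because \<sigma>
  itself is a representative.\<close>

lemma cohom_restrict_class:
  assumes "finer P Q" "open_pair P" "open_pair Q" "\<sigma> \<in> cocycles A q P"
  shows "cohom_restrict A q Q (cohom_class A q P \<sigma>) = cohom_class A q Q (cochain_restrict Q \<sigma>)"
proof -
  have *: "cohom_class A q Q (cochain_restrict Q \<tau>) = cohom_class A q Q (cochain_restrict Q \<sigma>)"
    if "\<tau> \<in> cohom_class A q P \<sigma>" for \<tau>
  proof -
    have \<tau>: "\<tau> \<in> cocycles A q P" "\<sigma> - \<tau> \<in> coboundaries A q P"
      using that by (auto simp: cohom_class_def cohomologous_iff)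
    have "cochain_restrict Q \<tau> - cochain_restrict Q \<sigma> \<in> coboundaries A q Q"
      using coboundaries_restrict[OF assms(1,3) coboundaries_minus[OF assms(2) \<tau>(2)]]
      by (simp add: cochain_restrict_diff)
    then show ?thesis
      using cohom_class_eq_iff[OF assms(3)] cocycles_restrict[OF assms(1,3)] \<tau>(1) assms(4) by simp
  qed
  have "\<sigma> \<in> cohom_class A q P \<sigma>"
    using assms(4) by (simp add: cohom_class_def cohomologous_iff coboundaries_0)
  then have "cohom_class A q P \<sigma> \<noteq> {}" by (rule ex_in_conv[THEN iffD1, OF exI])
  then show ?thesis unfolding cohom_restrict_def using * by (rule SUP_eq_const)
qed

text \<open>Equality of germs is brought down to cocycles: the difference becomes a coboundary after
  restriction. Later arguments about germs are conducted in this form.\<close>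

lemma limit_rel_iff:
  assumes I: "directed_pairs I" and P: "P \<in> I" "\<sigma> \<in> cocycles A q P" and Q: "Q \<in> I" "\<tau> \<in> cocycles A q Q"
  shows "((P, cohom_class A q P \<sigma>), (Q, cohom_class A q Q \<tau>)) \<in> limit_rel A q I \<longleftrightarrow>
    (\<exists>R\<in>I. finer P R \<and> finer Q R \<and> cochain_restrict R \<sigma> - cochain_restrict R \<tau> \<in> coboundaries A q R)"
proof -
  have op: "open_pair R" if "R \<in> I" for R using directed_pairs_open[OF I that] .
  have "cohom_restrict A q R (cohom_class A q P \<sigma>) = cohom_restrict A q R (cohom_class A q Q \<tau>) \<longleftrightarrow>
      cochain_restrict R \<sigma> - cochain_restrict R \<tau> \<in> coboundaries A q R"
    if "R \<in> I" "finer P R" "finer Q R" for R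
    using that P Q op
    by (simp add: cohom_restrict_class cohom_class_eq_iff cocycles_restrict)
  moreover have "cohom_class A q P \<sigma> \<in> cohomology A q P" "cohom_class A q Q \<tau> \<in> cohomology A q Q"
    using P Q by (auto simp: cohomology_iff)
  ultimately show ?thesis using P Q by (auto simp: limit_rel_def)
qed

text \<open>Directedness enters in transitivity: the two equalities hold on different refinements
  and are compared on a common refinement of these.\<close>

lemma equiv_limit_rel:
  assumes I: "directed_pairs I"
  shows "equiv (SIGMA P:I. cohomology A q P) (limit_rel A q I)"
proof (rule equivI)
  show "limit_rel A q I \<subseteq> (SIGMA P:I. cohomology A q P) \<times> (SIGMA P:I. cohomology A q P)"
    by (auto simp: limit_rel_def)
  show "refl_on (SIGMA P:I. cohomology A q P) (limit_rel A q I)"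
    by (auto simp: refl_on_def limit_rel_def intro: finer_refl)
  show "sym (limit_rel A q I)"
    unfolding sym_def limit_rel_def by auto
  show "trans (limit_rel A q I)"
  proof (rule transI)
    fix x y z assume xy: "(x, y) \<in> limit_rel A q I" and yz: "(y, z) \<in> limit_rel A q I"
    obtain P Q S h k l where eq: "x = (P, h)" "y = (Q, k)" "z = (S, l)" by (cases x, cases y, cases z) auto
    have PQS: "P \<in> I" "Q \<in> I" "S \<in> I" using xy yz unfolding eq by (auto simp: limit_rel_def)
    obtain \<sigma> \<tau> \<rho> where \<sigma>: "\<sigma> \<in> cocycles A q P" "h = cohom_class A q P \<sigma>"
      and \<tau>: "\<tau> \<in> cocycles A q Q" "k = cohom_class A q Q \<tau>"
      and \<rho>: "\<rho> \<in> cocycles A q S" "l = cohom_class A q S \<rho>"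
      using xy yz unfolding eq by (auto simp: limit_rel_def cohomology_iff)
    obtain R where R: "R \<in> I" "finer P R" "finer Q R"
        "cochain_restrict R \<sigma> - cochain_restrict R \<tau> \<in> coboundaries A q R"
      using xy limit_rel_iff[OF I PQS(1) \<sigma>(1) PQS(2) \<tau>(1)] unfolding eq \<sigma>(2) \<tau>(2) by blast
    obtain R' where R': "R' \<in> I" "finer Q R'" "finer S R'"
        "cochain_restrict R' \<tau> - cochain_restrict R' \<rho> \<in> coboundaries A q R'"
      using yz limit_rel_iff[OF I PQS(2) \<tau>(1) PQS(3) \<rho>(1)] unfolding eq \<tau>(2) \<rho>(2) by blast
    obtain T where T: "T \<in> I" "finer R T" "finer R' T" using directed_pairs_finer[OF I R(1) R'(1)] .
    have op: "open_pair T" using I T(1) by (simp add: directed_pairs_def)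
    have 1: "cochain_restrict T \<sigma> - cochain_restrict T \<tau> \<in> coboundaries A q T"
      using coboundaries_restrict[OF T(2) op R(4)]
      by (simp add: cochain_restrict_diff cochain_restrict_restrict[OF T(2)])
    have 2: "cochain_restrict T \<rho> - cochain_restrict T \<tau> \<in> coboundaries A q T"
      using coboundaries_minus[OF op, OF coboundaries_restrict[OF T(3) op R'(4), unfolded cochain_restrict_diff]]
      by (simp add: cochain_restrict_restrict[OF T(3)])
    have "cochain_restrict T \<sigma> - cochain_restrict T \<rho> \<in> coboundaries A q T"
      using coboundaries_diff[OF op 1 2] by simp
    then show "(x, z) \<in> limit_rel A q I"
      unfolding eq \<sigma>(2) \<rho>(2) limit_rel_iff[OF I PQS(1) \<sigma>(1) PQS(3) \<rho>(1)]
      using T finer_trans R(2) R'(3) by blast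
  qed
qed

lemma dir_limit_representative:
  assumes "u \<in> dir_limit A q I"
  obtains P \<sigma> where "P \<in> I" "\<sigma> \<in> cocycles A q P" "u = limit_rel A q I `` {(P, cohom_class A q P \<sigma>)}"
  using assms by (auto simp: dir_limit_def quotient_def cohomology_iff)

lemma dir_limit_memberD:
  assumes "u \<in> dir_limit A q I" "(P, h) \<in> u"
  obtains \<sigma> where "P \<in> I" "\<sigma> \<in> cocycles A q P" "h = cohom_class A q P \<sigma>"
  using assms by (auto simp: dir_limit_def quotient_def cohomology_iff limit_rel_def)

lemma dir_limit_mapI:
  assumes "(P, h) \<in> u" "Q \<in> J" "finer P Q" "x \<in> limit_rel A q J `` {(Q, cohom_restrict A q Q h)}"
  shows "x \<in> dir_limit_map A q J u"
  unfolding dir_limit_map_def using assms by blast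

text \<open>The zero classes on any two pairs agree on a common refinement, so the union defining
  the zero germ consists of copies of one class.\<close>

lemma dir_limit_zero_eq:
  assumes J: "directed_pairs J" and Q: "Q \<in> J"
  shows "dir_limit_zero A q J = limit_rel A q J `` {(Q, cohom_class A q Q 0)}"
proof -
  have eq: "limit_rel A q J `` {(P, cohom_class A q P 0)} = limit_rel A q J `` {(Q, cohom_class A q Q 0)}"
    if P: "P \<in> J" for P
  proof (rule equiv_class_eq[OF equiv_limit_rel[OF J]])
    obtain R where "R \<in> J" "finer P R" "finer Q R" using directed_pairs_finer[OF J P Q] .
    then show "((P, cohom_class A q P 0), (Q, cohom_class A q Q 0)) \<in> limit_rel A q J"
      unfolding limit_rel_iff[OF J P cocycles_0 Q cocycles_0] using coboundaries_0 by auto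
  qed
  have "(\<Union>P\<in>J. limit_rel A q J `` {(P, cohom_class A q P 0)}) = limit_rel A q J `` {(Q, cohom_class A q Q 0)}"
  proof (rule SUP_eq_const)
    show "J \<noteq> {}" using Q by blast
  qed (rule eq)
  then show ?thesis unfolding dir_limit_zero_def zero_prod_def .
qed

text \<open>The pair R on which the class vanishes can be forced below a prescribed Q, which later
  keeps its open set inside the domain of the representative.\<close>

lemma dir_limit_map_zeroD:
  assumes J: "directed_pairs J" and u: "dir_limit_map A q J u = dir_limit_zero A q J"
    and P: "(P, cohom_class A q P \<sigma>) \<in> u" "\<sigma> \<in> cocycles A q P" "open_pair P"
    and Q: "Q \<in> J" "finer P Q"
  obtains R where "R \<in> J" "finer Q R" "cochain_restrict R \<sigma> \<in> coboundaries A q R"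
proof -
  have op: "open_pair R" if "R \<in> J" for R using directed_pairs_open[OF J that] .
  let ?\<sigma> = "cochain_restrict Q \<sigma>"
  have \<sigma>: "?\<sigma> \<in> cocycles A q Q" by (rule cocycles_restrict[OF Q(2) op[OF Q(1)] P(2)])
  have "(Q, cohom_class A q Q ?\<sigma>) \<in> limit_rel A q J `` {(Q, cohom_class A q Q ?\<sigma>)}"
    by (rule equiv_class_self[OF equiv_limit_rel[OF J]]) (use Q \<sigma> in \<open>auto simp: cohomology_iff\<close>)
  then have "(Q, cohom_class A q Q ?\<sigma>) \<in> dir_limit_map A q J u"
    using cohom_restrict_class[OF Q(2) P(3) op[OF Q(1)] P(2)] dir_limit_mapI[OF P(1) Q] by metis
  then have "((Q, cohom_class A q Q 0), (Q, cohom_class A q Q ?\<sigma>)) \<in> limit_rel A q J"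
    unfolding u dir_limit_zero_eq[OF J Q(1)] by simp
  then obtain R where R: "R \<in> J" "finer Q R" "cochain_restrict R 0 - cochain_restrict R ?\<sigma> \<in> coboundaries A q R"
    unfolding limit_rel_iff[OF J Q(1) cocycles_0 Q(1) \<sigma>] by blast
  have "cochain_restrict R \<sigma> \<in> coboundaries A q R"
    using coboundaries_minus[OF op[OF R(1)] R(3)] R(2)
    by (simp add: cochain_restrict_restrict cochain_restrict_0)
  then show ?thesis using that R by blast
qed

text \<open>The image germ is a union over all representatives of u, so each of them has to be shown
  to give zero. Another representative \<sigma> agrees with \<tau> on a pair of I, whereas \<tau>
  vanishes on a pair of J; \<open>mixed\<close> provides a pair of J below both.\<close>

lemma dir_limit_map_zeroI:
  assumes I: "directed_pairs I" and J: "directed_pairs J"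
    and mixed: "\<And>R Q. R \<in> I \<Longrightarrow> Q \<in> J \<Longrightarrow> \<exists>S\<in>J. finer R S \<and> finer Q S"
    and u: "u \<in> dir_limit A q I"
    and P: "(P, cohom_class A q P \<tau>) \<in> u" "\<tau> \<in> cocycles A q P"
    and Q: "Q \<in> J" "finer P Q" "cochain_restrict Q \<tau> \<in> coboundaries A q Q"
  shows "dir_limit_map A q J u = dir_limit_zero A q J"
proof -
  have opI: "open_pair R" if "R \<in> I" for R using directed_pairs_open[OF I that] .
  have opJ: "open_pair R" if "R \<in> J" for R using directed_pairs_open[OF J that] .
  have PI: "P \<in> I" using dir_limit_memberD[OF u P(1)] by blast
  let ?Z = "limit_rel A q J `` {(Q, cohom_class A q Q 0)}"
  have eq: "limit_rel A q J `` {(Q', cohom_restrict A q Q' h')} = ?Z"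
    if h': "(P', h') \<in> u" and Q': "Q' \<in> J" "finer P' Q'" for P' h' Q'
  proof -
    obtain \<sigma> where \<sigma>: "P' \<in> I" "\<sigma> \<in> cocycles A q P'" "h' = cohom_class A q P' \<sigma>"
      using dir_limit_memberD[OF u h'] by blast
    have "((P, cohom_class A q P \<tau>), (P', cohom_class A q P' \<sigma>)) \<in> limit_rel A q I"
      using quotient_eq_iff[OF equiv_limit_rel[OF I], of u q u] u P(1) h' \<sigma>(3) by (simp add: dir_limit_def)
    then obtain R where R: "R \<in> I" "finer P R" "finer P' R"
        "cochain_restrict R \<tau> - cochain_restrict R \<sigma> \<in> coboundaries A q R"
      unfolding limit_rel_iff[OF I PI P(2) \<sigma>(1,2)] by blast
    \<comment> \<open>S' lies below Q, where \<tau> is a coboundary, and below Q', where \<sigma> is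
      to be tested; S lies in addition below R, where the two are compared.\<close>
    obtain S' where S': "S' \<in> J" "finer Q S'" "finer Q' S'" using directed_pairs_finer[OF J Q(1) Q'(1)] .
    obtain S where S: "S \<in> J" "finer R S" "finer S' S" using mixed[OF R(1) S'(1)] by blast
    have fin: "finer Q S" "finer Q' S" using S'(2,3) S(3) by (blast intro: finer_trans)+
    note op = opJ[OF S(1)]
    have "cochain_restrict S \<tau> \<in> coboundaries A q S"
      using coboundaries_restrict[OF fin(1) op Q(3)] by (simp add: cochain_restrict_restrict fin)
    moreover have "cochain_restrict S \<tau> - cochain_restrict S \<sigma> \<in> coboundaries A q S"
      using coboundaries_restrict[OF S(2) op R(4)] by (simp add: cochain_restrict_diff cochain_restrict_restrict S)
    ultimately have "cochain_restrict S \<sigma> \<in> coboundaries A q S"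
      using coboundaries_diff[OF op] by fastforce
    then have *: "cochain_restrict S (cochain_restrict Q' \<sigma>) - cochain_restrict S 0 \<in> coboundaries A q S"
      by (simp add: cochain_restrict_restrict fin cochain_restrict_0)
    have "cohom_restrict A q Q' h' = cohom_class A q Q' (cochain_restrict Q' \<sigma>)"
      unfolding \<sigma>(3) by (rule cohom_restrict_class[OF Q'(2) opI[OF \<sigma>(1)] opJ[OF Q'(1)] \<sigma>(2)])
    moreover have "((Q', cohom_class A q Q' (cochain_restrict Q' \<sigma>)), (Q, cohom_class A q Q 0)) \<in> limit_rel A q J"
      unfolding limit_rel_iff[OF J Q'(1) cocycles_restrict[OF Q'(2) opJ[OF Q'(1)] \<sigma>(2)] Q(1) cocycles_0]
      using * S(1) fin by blast
    ultimately show ?thesis using equiv_class_eq[OF equiv_limit_rel[OF J]] by metis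
  qed
  have "dir_limit_map A q J u = ?Z"
  proof
    show "dir_limit_map A q J u \<subseteq> ?Z" unfolding dir_limit_map_def using eq by blast
    show "?Z \<subseteq> dir_limit_map A q J u"
      unfolding eq[OF P(1) Q(1,2), symmetric] dir_limit_map_def using P(1) Q(1,2) by blast
  qed
  then show ?thesis unfolding dir_limit_zero_eq[OF J Q(1)] .
qed

end

section \<open>Cutting off a primitive\<close>

context holomorphic_atlas
begin

text \<open>The last hypothesis stands in for the general fact that dbar maps forms to forms. For a
  cut off primitive it comes from the Leibniz rule.\<close>

lemma vartheta_vartheta:
  assumes "open_pair (V, S)" "\<kappa>1 \<in> forms A q V" "\<kappa>01 \<in> forms A (q - 1) (V - S)"
    and "dbar A (V - S) \<kappa>01 \<in> forms A q (V - S)"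
  shows "vartheta A (V, S) (vartheta A (V, S) (\<kappa>1, \<kappa>01)) = 0"
proof -
  have op: "open V" "open (V - S)" using assms(1) by (auto simp: open_pair_def)
  have "form_restrict (V - S) \<kappa>1 \<in> forms A q (V - S)"
    by (rule forms_restrict[OF op(2) _ assms(2)]) auto
  then have "dbar A (V - S) (form_restrict (V - S) \<kappa>1 - dbar A (V - S) \<kappa>01) =
      dbar A (V - S) (form_restrict (V - S) \<kappa>1) - dbar A (V - S) (dbar A (V - S) \<kappa>01)"
    using assms(4) by (rule dbar_diff)
  also have "\<dots> = form_restrict (V - S) (dbar A V \<kappa>1)"
    using dbar_restrict[OF op(2), of V \<kappa>1] dbar_dbar[OF op(2) assms(3)] by simp
  finally show ?thesis
    by (simp add: vartheta_def dbar_dbar[OF op(1) assms(2)] zero_prod_def)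
qed

text \<open>The second component of a primitive of \<open>\<sigma>\<close> on \<open>(V, S)\<close> is multiplied by a smooth function
  that vanishes near \<open>S\<close> and is one on \<open>E1\<close>; the result is defined on all of \<open>V - M\<close>, and
  subtracting the coboundary from \<open>\<sigma>\<close> kills \<open>\<sigma>\<close> on \<open>E1\<close>.\<close>

lemma supported_representative:
  assumes op: "open_pair (V, M)" "open_pair (V, S)" and MS: "V \<inter> M \<subseteq> S"
    and c: "c \<in> A" "V \<subseteq> fst c"
    and YZ: "open Y" "open Z" "Y \<union> Z = V - M"
    and E0: "open E0" "E0 \<subseteq> V - M - Z" "V - M \<subseteq> (V - S) \<union> E0"
    and E1: "open E1" "E1 \<subseteq> V - M - Y" "E1 \<inter> S = {}"
    and \<sigma>: "\<sigma> \<in> cocycles A q (V, M)" "cochain_restrict (V, S) \<sigma> \<in> coboundaries A q (V, S)"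
  obtains \<tau>01 where "(0, \<tau>01) \<in> cocycles A q (V, M)"
    "\<sigma> - (0, \<tau>01) \<in> coboundaries A q (V, M)" "\<And>x. x \<in> E1 \<Longrightarrow> \<tau>01 x = 0"
proof -
  let ?V1 = "V - S" and ?VM = "V - M"
  have opn: "open V" "open ?VM" "open ?V1" using op by (auto simp: open_pair_def)
  have V1: "?V1 \<subseteq> ?VM" using MS by auto
  obtain \<sigma>1 \<sigma>01 where \<sigma>eq: "\<sigma> = (\<sigma>1, \<sigma>01)" by (cases \<sigma>)
  have \<sigma>f: "\<sigma>1 \<in> forms A q V" "\<sigma>01 \<in> forms A (q - 1) ?VM"
    using \<sigma>(1) by (auto simp: \<sigma>eq cocycles_def cochains_def)
  have \<sigma>V: "form_restrict V \<sigma>1 = \<sigma>1" "form_restrict ?VM \<sigma>01 = \<sigma>01"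
    using forms_outside[OF \<sigma>f(1)] forms_outside[OF \<sigma>f(2)] by (auto simp: form_restrict_def)
  obtain \<rho> where \<rho>: "\<rho> \<in> cochains A (q - 1) (V, S)" "cochain_restrict (V, S) \<sigma> = vartheta A (V, S) \<rho>"
    using \<sigma>(2) unfolding coboundaries_def by blast
  obtain \<rho>1 \<rho>01 where \<rho>eq: "\<rho> = (\<rho>1, \<rho>01)" by (cases \<rho>)
  have \<rho>f: "\<rho>1 \<in> forms A (q - 1) V" "\<rho>01 \<in> forms A (q - 1 - 1) ?V1"
    using \<rho>(1) by (auto simp: \<rho>eq cochains_def)
  have d\<rho>1: "dbar A V \<rho>1 = \<sigma>1" and r01: "form_restrict ?V1 \<sigma>01 = form_restrict ?V1 \<rho>1 - dbar A ?V1 \<rho>01"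
    using \<rho>(2) \<sigma>V(1) by (auto simp: \<sigma>eq \<rho>eq cochain_restrict_def vartheta_def)
  then have d\<rho>01: "dbar A ?V1 \<rho>01 = form_restrict ?V1 \<rho>1 - form_restrict ?V1 \<sigma>01" by simp
  \<comment> \<open>The equation of the primitive writes dbar \<open>\<rho>01\<close> as a
    difference of forms; this is the input for the Leibniz rule.\<close>
  have d\<rho>01_mem: "dbar A ?V1 \<rho>01 \<in> forms A (q - 1 - 1 + 1) ?V1"
    unfolding d\<rho>01 using forms_diff[OF opn(3) forms_restrict[OF opn(3) _ \<rho>f(1)] forms_restrict[OF opn(3) V1 \<sigma>f(2)]]
    by auto
  \<comment> \<open>The separation takes place over V - M and not over V, since the sets where the
    function is to be 1 and 0 may both accumulate at M.\<close>
  have "snd c ` ?VM \<subseteq> snd c ` (Y \<inter> fst c) \<union> snd c ` (Z \<inter> fst c)"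
    using YZ(3) c(2) by blast
  then obtain \<theta>0 :: "complex^'n \<Rightarrow> real" where \<theta>0: "smooth_on (snd c ` ?VM) \<theta>0"
      "\<And>z. z \<in> snd c ` ?VM - snd c ` (Y \<inter> fst c) \<Longrightarrow> \<theta>0 z = 1"
      "\<And>z. z \<in> snd c ` ?VM - snd c ` (Z \<inter> fst c) \<Longrightarrow> \<theta>0 z = 0"
    using smooth_separation[OF open_chart_image[OF c(1) YZ(1)] open_chart_image[OF c(1) YZ(2)]] by blast
  have inj: "inj_on (snd c) (fst c)" using chart_inv_chart[OF c(1)] by (metis inj_onI)
  define \<theta> where "\<theta> x = complex_of_real (\<theta>0 (snd c x))" for x
  have image: "snd c x \<notin> snd c ` (T \<inter> fst c)" if "x \<in> V" "x \<notin> T" for x T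
  proof
    assume "snd c x \<in> snd c ` (T \<inter> fst c)"
    then obtain y where "y \<in> T" "y \<in> fst c" "snd c x = snd c y" by blast
    then have "x = y" using inj_onD[OF inj] c(2) that(1) by blast
    then show False using \<open>y \<in> T\<close> that(2) by simp
  qed
  have \<theta>1: "\<theta> x = 1" if "x \<in> E1" for x
  proof -
    have "x \<in> ?VM" "x \<notin> Y" using that E1(2) by auto
    then show ?thesis using \<theta>0(2)[of "snd c x"] image[of x Y] by (simp add: \<theta>_def)
  qed
  have \<theta>z: "\<theta> x = 0" if "x \<in> E0" for x
  proof -
    have "x \<in> ?VM" "x \<notin> Z" using that E0(2) by auto
    then show ?thesis using \<theta>0(3)[of "snd c x"] image[of x Z] by (simp add: \<theta>_def)
  qed
  have VMc: "?VM \<subseteq> fst c" using c(2) by auto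
  have "open (snd c ` ?VM)" using open_chart_image[OF c(1) opn(2)] VMc by (simp add: Int_absorb2)
  then have "smooth_fun A ?VM \<theta>"
    unfolding \<theta>_def
    by (intro smooth_fun_of_chart[OF c(1) opn(2) VMc] smooth_on_bounded_linear[OF _ bounded_linear_of_real \<theta>0(1)])
  then have \<theta>s: "smooth_fun A ?V1 \<theta>"
    unfolding smooth_fun_def using V1 by (auto intro: smooth_on_subset)
  \<comment> \<open>Outside V - S the form \<open>\<rho>01\<close> is zero by convention. On the
    open set \<open>E0\<close>, which contains the rest of V - M, the factor \<theta> vanishes, so
    the product is smooth across the boundary of S.\<close>
  define \<eta> where "\<eta> = scale_form \<theta> \<rho>01"
  have \<eta>0: "\<eta> x = 0" if "x \<in> E0" for x
    using \<theta>z[OF that] by (simp add: \<eta>_def scale_form_def zero_fun_def)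
  have \<eta>V1: "\<eta> \<in> forms A (q - 1 - 1) ?V1"
    unfolding \<eta>_def by (rule scale_form_mem[OF opn(3) \<theta>s \<rho>f(2)])
  have d\<eta>V1: "dbar A ?V1 \<eta> \<in> forms A (q - 1) ?V1"
    using dbar_scale_form_mem[OF opn(3) \<theta>s \<rho>f(2) d\<rho>01_mem] by (simp add: \<eta>_def)
  have \<eta>: "\<eta> \<in> forms A (q - 1 - 1) ?VM"
  proof (rule forms_glue)
    show "\<eta> x = 0" if "x \<notin> ?VM" for x
      using forms_outside[OF \<eta>V1] that V1 by blast
    show "\<exists>N \<eta>'. open N \<and> x \<in> N \<and> \<eta>' \<in> forms A (q - 1 - 1) N \<and> (\<forall>y\<in>N. \<eta> y = \<eta>' y)" if x: "x \<in> ?VM" for x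
    proof (cases "x \<in> E0")
      case True
      then show ?thesis using E0(1) forms_0 \<eta>0 by (intro exI[of _ E0] exI[of _ 0]) auto
    next
      case False
      then have "x \<in> ?V1" using E0(3) x by blast
      then show ?thesis using opn(3) \<eta>V1 by (intro exI[of _ "?V1"] exI[of _ \<eta>]) blast
    qed
  qed
  have d\<eta>_eq: "dbar A ?VM \<eta> x = dbar A ?V1 \<eta> x" if "x \<in> ?V1" for x
    by (rule dbar_cong[OF opn(3) that V1 order_refl]) simp
  have d\<eta>: "dbar A ?VM \<eta> \<in> forms A (q - 1) ?VM"
  proof (rule forms_glue)
    show "dbar A ?VM \<eta> x = 0" if "x \<notin> ?VM" for x by (rule dbar_outside[OF that])
    show "\<exists>N \<eta>'. open N \<and> x \<in> N \<and> \<eta>' \<in> forms A (q - 1) N \<and> (\<forall>y\<in>N. dbar A ?VM \<eta> y = \<eta>' y)" if x: "x \<in> ?VM" for x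
    proof (cases "x \<in> E0")
      case True
      have "dbar A ?VM \<eta> y = 0 y" if "y \<in> E0" for y
      proof -
        have "dbar A ?VM \<eta> y = dbar A E0 0 y"
          by (rule dbar_cong[OF E0(1) that]) (use E0(2) \<eta>0 in auto)
        then show ?thesis by (simp add: dbar_0)
      qed
      then show ?thesis using E0(1) forms_0 True by (intro exI[of _ E0] exI[of _ 0]) auto
    next
      case False
      then have "x \<in> ?V1" using E0(3) x by blast
      then show ?thesis using opn(3) d\<eta>V1 d\<eta>_eq by (intro exI[of _ "?V1"] exI[of _ "dbar A ?V1 \<eta>"]) blast
    qed
  qed
  \<comment> \<open>The second component of \<sigma> minus the image of
    \<open>(\<rho>1, \<eta>)\<close>; the first component of that difference is zero because dbar
    \<open>\<rho>1\<close> = \<open>\<sigma>1\<close>.\<close>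
  define \<tau>01 where "\<tau>01 = \<sigma>01 - (form_restrict ?VM \<rho>1 - dbar A ?VM \<eta>)"
  have v: "vartheta A (V, M) (\<rho>1, \<eta>) = (\<sigma>1, form_restrict ?VM \<rho>1 - dbar A ?VM \<eta>)"
    by (simp add: vartheta_def d\<rho>1)
  have \<kappa>: "(\<rho>1, \<eta>) \<in> cochains A (q - 1) (V, M)"
    using \<rho>f(1) \<eta> by (simp add: cochains_def)
  have v_mem: "vartheta A (V, M) (\<rho>1, \<eta>) \<in> cochains A q (V, M)"
    unfolding v using \<sigma>f(1) forms_diff[OF opn(2) forms_restrict[OF opn(2) _ \<rho>f(1)] d\<eta>]
    by (auto simp: cochains_def)
  have \<tau>: "(0, \<tau>01) = \<sigma> - vartheta A (V, M) (\<rho>1, \<eta>)"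
    by (simp add: v \<sigma>eq \<tau>01_def)
  show ?thesis
  proof
    have "vartheta A (V, M) (\<sigma> - vartheta A (V, M) (\<rho>1, \<eta>)) = 0"
      using \<sigma>(1) v_mem vartheta_vartheta[OF op(1) \<rho>f(1) \<eta> d\<eta>]
      by (simp add: cocycles_iff vartheta_diff[OF _ v_mem])
    then show "(0, \<tau>01) \<in> cocycles A q (V, M)"
      using \<sigma>(1) v_mem cochains_diff[OF op(1)] by (simp add: cocycles_iff \<tau>)
    show "\<sigma> - (0, \<tau>01) \<in> coboundaries A q (V, M)"
      unfolding \<tau> coboundaries_def using \<kappa> by simp
    show "\<tau>01 x = 0" if x: "x \<in> E1" for x
    proof -
      have x1: "x \<in> ?V1" using x E1(2,3) by auto
      \<comment> \<open>On the open set \<open>E1\<close> the factor is 1, so \<eta> and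
        \<open>\<rho>01\<close> have the same dbar there, and the equation of the primitive cancels
        \<open>\<sigma>01\<close>.\<close>
      have "dbar A ?VM \<eta> x = dbar A ?V1 \<rho>01 x"
        by (rule dbar_cong[OF E1(1) x])
          (use E1(2,3) \<theta>1 in \<open>auto simp: \<eta>_def scale_form_def\<close>)
      moreover have "x \<notin> M" using x E1(2) by auto
      ultimately show ?thesis using x1 by (simp add: \<tau>01_def d\<rho>01 form_restrict_def)
    qed
  qed
qed

end

section \<open>Cones and tubes\<close>

text \<open>The pairing with \<xi> attains a negative maximum -d on the compact set of unit vectors
  of G, and homogeneity spreads the bound over G. If there are no unit vectors, G is the origin and
  any d > 0 will do.\<close>

lemma closed_cone_gap:
  assumes "closed_cone G" "G - {0} \<subseteq> {y. y \<bullet> \<xi> < 0}"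
  obtains d where "0 < d" "\<And>y. y \<in> G \<Longrightarrow> y \<bullet> \<xi> \<le> - d * norm y"
proof -
  have normed: "y /\<^sub>R norm y \<in> G \<inter> sphere 0 1" if "y \<in> G" "y \<noteq> 0" for y
    using that assms(1) by (auto simp: closed_cone_def cone_def)
  show ?thesis
  proof (cases "G \<inter> sphere 0 1 = {}")
    case True
    then have "y = 0" if "y \<in> G" for y using normed that by blast
    then show ?thesis using that[of 1] by force
  next
    case False
    have "compact (G \<inter> sphere 0 1)"
      using assms(1) by (auto simp: closed_cone_def intro: closed_Int_compact)
    then obtain y0 where y0: "y0 \<in> G \<inter> sphere 0 1" "\<And>y. y \<in> G \<inter> sphere 0 1 \<Longrightarrow> y \<bullet> \<xi> \<le> y0 \<bullet> \<xi>"
      using continuous_attains_sup[of "G \<inter> sphere 0 1" "\<lambda>y. y \<bullet> \<xi>"] False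
        continuous_on_inner[OF continuous_on_id continuous_on_const]
      by blast
    have neg: "y0 \<bullet> \<xi> < 0" using y0(1) assms(2) by auto
    show ?thesis
    proof (rule that[of "- (y0 \<bullet> \<xi>)"])
      fix y assume y: "y \<in> G"
      show "y \<bullet> \<xi> \<le> - (- (y0 \<bullet> \<xi>)) * norm y"
      proof (cases "y = 0")
        case False
        have "(y /\<^sub>R norm y) \<bullet> \<xi> \<le> y0 \<bullet> \<xi>" by (rule y0(2)[OF normed[OF y False]])
        then show ?thesis using False by (simp add: field_simps)
      qed simp
    qed (use neg in simp)
  qed
qed

text \<open>The enlarged cone has this shape; for d > 0 it meets the hyperplane orthogonal to \<xi>
  at most at the origin.\<close>

lemma closed_cone_halfspace: "closed_cone {y. y \<bullet> \<xi> \<le> - d * norm y}"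
  unfolding closed_cone_def
proof (intro conjI)
  show "closed {y. y \<bullet> \<xi> \<le> - d * norm y}" by (intro closed_Collect_le continuous_intros)
  have "c * (y \<bullet> \<xi>) \<le> c * (- d * norm y)" if "0 \<le> c" "y \<bullet> \<xi> \<le> - d * norm y" for c :: real and y
    using mult_left_mono[OF that(2,1)] .
  then show "cone {y. y \<bullet> \<xi> \<le> - d * norm y}" by (fastforce simp: cone_def algebra_simps)
qed simp

lemma closed_cone_Un: "closed_cone G \<Longrightarrow> closed_cone G' \<Longrightarrow> closed_cone (G \<union> G')"
  by (auto simp: closed_cone_def cone_def)

lemma continuous_on_im_vec: "continuous_on S im_vec"
  unfolding im_vec_def by (intro continuous_intros)

lemma im_vec_eq_0_iff: "im_vec z = 0 \<longleftrightarrow> z \<in> real_subspace"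
  by (simp add: im_vec_def real_subspace_def vec_eq_iff)

lemma tube_Un: "tube W \<Phi> (G \<union> G') = tube W \<Phi> G \<union> tube W \<Phi> G'"
  by (auto simp: tube_def)

lemma Re_bilin_i_vec: "Re (bilin (i_vec y) (i_vec \<xi>)) = - (y \<bullet> \<xi>)"
  by (simp add: bilin_def i_vec_def inner_vec_def sum_negf)

lemma finer_iff: "finer (V, S) (V', S') \<longleftrightarrow> V' \<subseteq> V \<and> V' \<inter> S \<subseteq> S'"
  by (simp add: finer_def)

section \<open>Directedness of the two families of pairs\<close>

lemma directed_hyperfunction_pairs:
  assumes "closed M"
  shows "directed_pairs (hyperfunction_pairs M x0)"
  unfolding directed_pairs_def
proof (intro conjI ballI)
  show "open_pair P" if "P \<in> hyperfunction_pairs M x0" for P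
    using that assms by (auto simp: hyperfunction_pairs_def open_pair_def)
  fix P Q assume "P \<in> hyperfunction_pairs M x0" "Q \<in> hyperfunction_pairs M x0"
  then obtain V V' where "P = (V, M)" "open V" "x0 \<in> V" "Q = (V', M)" "open V'" "x0 \<in> V'"
    by (auto simp: hyperfunction_pairs_def)
  then show "\<exists>R\<in>hyperfunction_pairs M x0. finer P R \<and> finer Q R"
    by (intro bexI[of _ "(V \<inter> V', M)"]) (auto simp: hyperfunction_pairs_def finer_iff)
qed

lemma open_im_vec_preimage:
  assumes "open W" "continuous_on W \<Phi>" "open T"
  shows "open {x \<in> W. im_vec (\<Phi> x) \<in> T}"
proof -
  have "continuous_on W (\<lambda>x. im_vec (\<Phi> x))"
    using continuous_on_compose2[OF continuous_on_im_vec assms(2)] by blast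
  then have "open ((\<lambda>x. im_vec (\<Phi> x)) -` T \<inter> W)"
    using assms by (simp add: continuous_on_open_vimage)
  moreover have "(\<lambda>x. im_vec (\<Phi> x)) -` T \<inter> W = {x \<in> W. im_vec (\<Phi> x) \<in> T}" by auto
  ultimately show ?thesis by simp
qed

lemma open_diff_tube:
  assumes "open W" "continuous_on W \<Phi>" "closed G" "open V" "V \<subseteq> W"
  shows "open (V - tube W \<Phi> G)"
proof -
  have "V - tube W \<Phi> G = V \<inter> {x \<in> W. im_vec (\<Phi> x) \<in> - G}"
    using assms(5) by (auto simp: tube_def)
  then show ?thesis using open_im_vec_preimage[OF assms(1,2), of "- G"] assms(3,4) by auto
qed

lemma microfunction_pairsI:
  "open V \<Longrightarrow> x0 \<in> V \<Longrightarrow> V \<subseteq> W \<Longrightarrow> closed_cone G \<Longrightarrow> G - {0} \<subseteq> {y. y \<bullet> \<xi>0 < 0} \<Longrightarrow>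
    (V, tube W \<Phi> G) \<in> microfunction_pairs W \<Phi> x0 \<xi>0"
  unfolding microfunction_pairs_def by blast

lemma microfunction_pairsE:
  assumes "P \<in> microfunction_pairs W \<Phi> x0 \<xi>0"
  obtains V G where "P = (V, tube W \<Phi> G)" "open V" "x0 \<in> V" "V \<subseteq> W" "closed_cone G"
    "G - {0} \<subseteq> {y. y \<bullet> \<xi>0 < 0}"
  using assms unfolding microfunction_pairs_def by blast

text \<open>A finer pair has a smaller V but a larger cone, so a common refinement intersects
  neighbourhoods and unites cones. Convexity is not part of \<open>closed_cone\<close>, and the half
  space condition passes to unions.\<close>

lemma directed_microfunction_pairs:
  assumes "open W" "continuous_on W \<Phi>"
  shows "directed_pairs (microfunction_pairs W \<Phi> x0 \<xi>0)"
  unfolding directed_pairs_def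
proof (intro conjI ballI)
  show "open_pair P" if P: "P \<in> microfunction_pairs W \<Phi> x0 \<xi>0" for P
    using P
  proof (rule microfunction_pairsE)
    fix V G assume "P = (V, tube W \<Phi> G)" "open V" "V \<subseteq> W" "closed_cone G"
    then show ?thesis
      using open_diff_tube[OF assms, of G V] by (simp add: open_pair_def closed_cone_def)
  qed
  fix P Q assume P: "P \<in> microfunction_pairs W \<Phi> x0 \<xi>0" and Q: "Q \<in> microfunction_pairs W \<Phi> x0 \<xi>0"
  obtain V G where VG: "P = (V, tube W \<Phi> G)" "open V" "x0 \<in> V" "V \<subseteq> W" "closed_cone G"
    "G - {0} \<subseteq> {y. y \<bullet> \<xi>0 < 0}" using P by (rule microfunction_pairsE)
  obtain V' G' where VG': "Q = (V', tube W \<Phi> G')" "open V'" "x0 \<in> V'" "V' \<subseteq> W" "closed_cone G'"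
    "G' - {0} \<subseteq> {y. y \<bullet> \<xi>0 < 0}" using Q by (rule microfunction_pairsE)
  have "(V \<inter> V', tube W \<Phi> (G \<union> G')) \<in> microfunction_pairs W \<Phi> x0 \<xi>0"
    using VG VG' by (intro microfunction_pairsI closed_cone_Un) auto
  moreover have "finer P (V \<inter> V', tube W \<Phi> (G \<union> G'))" "finer Q (V \<inter> V', tube W \<Phi> (G \<union> G'))"
    by (auto simp: VG(1) VG'(1) finer_iff tube_Un)
  ultimately show "\<exists>R\<in>microfunction_pairs W \<Phi> x0 \<xi>0. finer P R \<and> finer Q R" by blast
qed

text \<open>Equality of images alone would permit a point of W outside M to land in the real
  subspace; injectivity of \<Phi> excludes it.\<close>

lemma C1_trivialization_mem_iff:
  assumes "C1_trivialization A M x0 W \<Phi>" "x \<in> W"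
  shows "x \<in> M \<longleftrightarrow> im_vec (\<Phi> x) = 0"
proof -
  have "inj_on \<Phi> W" and eq: "\<Phi> ` (W \<inter> M) = \<Phi> ` W \<inter> real_subspace"
    using assms(1) by (auto simp: C1_trivialization_def dest: homeomorphism_apply1 intro: inj_on_inverseI)
  then have "\<Phi> x \<in> \<Phi> ` (W \<inter> M) \<longleftrightarrow> x \<in> M" using assms(2) inj_on_image_mem_iff[of \<Phi> W x "W \<inter> M"] by simp
  then show ?thesis using assms(2) unfolding eq im_vec_eq_0_iff by simp
qed

text \<open>Three slopes d > d/2 > d/3. The cut-off is 0 where y.\<xi> <= -(d/2)|y|, which leaves
  room around G since G satisfies the bound with d, and it is 1 where y.\<xi> >= -(d/3)|y|, that is
  outside the interior of the enlarged cone \<open>G'\<close>.\<close>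

lemma representative_supported_in_tube:
  fixes A :: "('a::topological_space, 'n::finite) chart set" and \<Phi> :: "'a \<Rightarrow> complex^'n"
  assumes "holomorphic_atlas A" and W: "open W" "continuous_on W \<Phi>"
    and M: "closed M" "\<And>x. x \<in> W \<Longrightarrow> x \<in> M \<longleftrightarrow> im_vec (\<Phi> x) = 0"
    and V: "open V" "V \<subseteq> W" "V \<subseteq> fst c" "c \<in> A"
    and G: "closed_cone G" "G - {0} \<subseteq> {y. y \<bullet> \<xi> < 0}"
    and \<sigma>: "\<sigma> \<in> cocycles A q (V, M)"
      "cochain_restrict (V, tube W \<Phi> G) \<sigma> \<in> coboundaries A q (V, tube W \<Phi> G)"
  obtains G' \<tau>01 where "closed_cone G'" "G' - {0} \<subseteq> {y. y \<bullet> \<xi> < 0}"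
    "(0, \<tau>01) \<in> cocycles A q (V, M)" "\<sigma> - (0, \<tau>01) \<in> coboundaries A q (V, M)"
    "form_support (V - M) \<tau>01 \<subseteq> tube W \<Phi> G'"
proof -
  interpret holomorphic_atlas A by fact
  obtain d where d: "0 < d" "\<And>y. y \<in> G \<Longrightarrow> y \<bullet> \<xi> \<le> - d * norm y"
    using closed_cone_gap[OF G] by blast
  define G' where "G' = {y. y \<bullet> \<xi> \<le> - (d / 3) * norm y}"
  define E where "E T = {x \<in> V. im_vec (\<Phi> x) \<in> T}" for T
  have E_open: "open (E T)" if "open T" for T
  proof -
    have "E T = V \<inter> {x \<in> W. im_vec (\<Phi> x) \<in> T}" using V(2) by (auto simp: E_def)
    then show ?thesis using open_im_vec_preimage[OF W that] V(1) by auto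
  qed
  \<comment> \<open>\<open>B e\<close> and \<open>C e\<close> are the two open sides of the cone of
    slope e, without the origin. \<open>B (d / 3)\<close> and \<open>C (d / 2)\<close> overlap
    because d/3 < d/2 and cover V - M; the cut-off is to vanish on \<open>B (d / 2)\<close> and to
    be 1 on \<open>C (d / 3)\<close>.\<close>
  define B where "B e = {y. y \<noteq> 0 \<and> y \<bullet> \<xi> < - e * norm y}" for e
  define C where "C e = {y. y \<noteq> 0 \<and> - e * norm y < y \<bullet> \<xi>}" for e
  have "open {y. y \<noteq> 0 \<and> y \<bullet> \<xi> < - e * norm y}" "open {y. y \<noteq> 0 \<and> - e * norm y < y \<bullet> \<xi>}" for e
    by (intro open_Collect_conj open_Collect_neq open_Collect_less continuous_intros)+
  then have opB: "open (B e)" and opC: "open (C e)" for e by (simp_all add: B_def C_def)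
  have mem_M: "x \<in> M \<longleftrightarrow> im_vec (\<Phi> x) = 0" if "x \<in> V" for x
    using M(2) V(2) that by blast
  have VM: "x \<in> V - M \<longleftrightarrow> x \<in> V \<and> im_vec (\<Phi> x) \<noteq> 0" for x
    using M(2) V(2) by auto
  have less: "d / 3 * norm y < d / 2 * norm y" "d / 2 * norm y < d * norm y" if "y \<noteq> 0" for y :: "real^'n"
    using that d(1) by simp_all
  have pair: "open_pair (V, M)" "open_pair (V, tube W \<Phi> G)"
    using V(1,2) M(1) open_diff_tube[OF W, of G V] G(1) by (auto simp: open_pair_def closed_cone_def)
  have "V \<inter> M \<subseteq> tube W \<Phi> G"
    using M(2) V(2) G(1) by (auto simp: tube_def closed_cone_def)
  moreover have "E (B (d / 3)) \<union> E (C (d / 2)) = V - M"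
  proof (intro equalityI subsetI)
    fix x assume x: "x \<in> V - M"
    then have "d / 3 * norm (im_vec (\<Phi> x)) < d / 2 * norm (im_vec (\<Phi> x))" using VM[of x] by (intro less(1)) blast
    then show "x \<in> E (B (d / 3)) \<union> E (C (d / 2))" using x by (auto simp: VM E_def B_def C_def)
  qed (unfold VM, auto simp: E_def B_def C_def)
  moreover have "E (B (d / 2)) \<subseteq> V - M - E (C (d / 2))"
    by (auto simp: mem_M E_def B_def C_def)
  moreover have "V - M \<subseteq> (V - tube W \<Phi> G) \<union> E (B (d / 2))"
  proof
    fix x assume x: "x \<in> V - M"
    show "x \<in> (V - tube W \<Phi> G) \<union> E (B (d / 2))"
    proof (cases "im_vec (\<Phi> x) \<in> G")
      case True
      then show ?thesis using x d(2)[OF True] less(2)[of "im_vec (\<Phi> x)"] by (auto simp: mem_M E_def B_def)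
    next
      case False
      then show ?thesis using x by (auto simp: tube_def)
    qed
  qed
  moreover have "E (C (d / 3)) \<subseteq> V - M - E (B (d / 3))"
    by (auto simp: mem_M E_def B_def C_def)
  moreover have "E (C (d / 3)) \<inter> tube W \<Phi> G = {}"
    using d(2) less by (force simp: E_def C_def tube_def)
  ultimately obtain \<tau>01 where \<tau>: "(0, \<tau>01) \<in> cocycles A q (V, M)" "\<sigma> - (0, \<tau>01) \<in> coboundaries A q (V, M)"
    and zero: "\<And>x. x \<in> E (C (d / 3)) \<Longrightarrow> \<tau>01 x = 0"
    using supported_representative[OF pair _ V(4,3) E_open[OF opB] E_open[OF opC] _ E_open[OF opB] _ _
        E_open[OF opC] _ _ \<sigma>] by metis
  show ?thesis
  proof
    show "closed_cone G'" unfolding G'_def by (rule closed_cone_halfspace)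
    show "G' - {0} \<subseteq> {y. y \<bullet> \<xi> < 0}"
    proof
      fix y assume y: "y \<in> G' - {0}"
      then have "0 < d / 3 * norm y" using d(1) by simp
      then show "y \<in> {y. y \<bullet> \<xi> < 0}" using y by (auto simp: G'_def)
    qed
    show "form_support (V - M) \<tau>01 \<subseteq> tube W \<Phi> G'"
    proof
      fix x assume x: "x \<in> form_support (V - M) \<tau>01"
      \<comment> \<open>The set of vanishing is open, so the closure in the definition of the
        support avoids it too.\<close>
      have "E (C (d / 3)) \<inter> closure {x \<in> V - M. \<tau>01 x \<noteq> 0} = {}"
        using zero by (subst open_Int_closure_eq_empty[OF E_open[OF opC]]) auto
      then have "x \<notin> E (C (d / 3))" "x \<in> V - M" using x by (auto simp: form_support_def)
      then show "x \<in> tube W \<Phi> G'" using V(2) by (auto simp: VM E_def C_def tube_def G'_def)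
    qed
  qed (rule \<tau>)+
qed

theorem proposition7p22:
  fixes A B :: "('a::{t2_space,second_countable_topology}, 'n::finite) chart set"
    and M W :: "'a set" and x0 :: 'a
    and \<Phi> :: "'a \<Rightarrow> complex^'n"
    and p0 :: "('a, 'n) chart \<Rightarrow> complex^'n \<Rightarrow> real"
    and \<xi>0 :: "real^'n"
    and u :: "('a, 'n) germ"
  assumes "oriented_complexification A B M"
    and "conormal_covector A B M x0 p0"
    and "C1_trivialization A M x0 W \<Phi>"
    and "trivialized_covector A \<Phi> x0 p0 \<xi>0"
    and "u \<in> hyperfunction_stalk A M x0"
  shows "{y. 0 < Re (bilin (i_vec y) (i_vec \<xi>0))} = {y. y \<bullet> \<xi>0 < 0} \<and>
    (microlocally_analytic A W \<Phi> x0 \<xi>0 u \<longleftrightarrow>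
      (\<exists>G V \<tau>1 \<tau>01.
        closed_cone G \<and> G - {0} \<subseteq> {y. 0 < Re (bilin (i_vec y) (i_vec \<xi>0))} \<and>
        open V \<and> x0 \<in> V \<and> V \<subseteq> W \<and>
        \<tau>1 \<in> forms A (int CARD('n)) V \<and> \<tau>01 \<in> forms A (int CARD('n) - 1) (V - M) \<and>
        represents A M V (\<tau>1, \<tau>01) u \<and>
        \<tau>1 = 0 \<and> form_support (V - M) \<tau>01 \<subseteq> tube W \<Phi> G))"
proof (intro conjI)
  have half: "{y. 0 < Re (bilin (i_vec y) (i_vec \<xi>0))} = {y. y \<bullet> \<xi>0 < 0}"
    by (simp add: Re_bilin_i_vec)
  then show "{y. 0 < Re (bilin (i_vec y) (i_vec \<xi>0))} = {y. y \<bullet> \<xi>0 < 0}" .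
  interpret holomorphic_atlas A
    by unfold_locales (use assms(1) in \<open>simp add: oriented_complexification_def\<close>)
  let ?n = "int CARD('n)" and ?I = "hyperfunction_pairs M x0" and ?J = "microfunction_pairs W \<Phi> x0 \<xi>0"
  have M: "closed M" using assms(1) by (simp add: oriented_complexification_def)
  have W: "open W" "x0 \<in> W" "continuous_on W \<Phi>"
    using assms(3) by (auto simp: C1_trivialization_def homeomorphism_def)
  have MW: "x \<in> M \<longleftrightarrow> im_vec (\<Phi> x) = 0" if "x \<in> W" for x
    by (rule C1_trivialization_mem_iff[OF assms(3) that])
  have I: "directed_pairs ?I" by (rule directed_hyperfunction_pairs[OF M])
  have J: "directed_pairs ?J" by (rule directed_microfunction_pairs[OF W(1,3)])
  have u: "u \<in> dir_limit A ?n ?I" using assms(5) by (simp add: hyperfunction_stalk_def)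
  \<comment> \<open>Cones contain the origin, so each tube contains the part of M in W; this makes
    restriction from hyperfunction pairs to microfunction pairs meaningful.\<close>
  have finer_tube: "finer (V, M) (V', tube W \<Phi> G)" if "V' \<subseteq> V" "V' \<subseteq> W" "closed_cone G" for V V' G
    using that MW by (auto simp: finer_iff tube_def closed_cone_def)
  show "microlocally_analytic A W \<Phi> x0 \<xi>0 u \<longleftrightarrow>
      (\<exists>G V \<tau>1 \<tau>01.
        closed_cone G \<and> G - {0} \<subseteq> {y. 0 < Re (bilin (i_vec y) (i_vec \<xi>0))} \<and>
        open V \<and> x0 \<in> V \<and> V \<subseteq> W \<and>
        \<tau>1 \<in> forms A ?n V \<and> \<tau>01 \<in> forms A (?n - 1) (V - M) \<and>
        represents A M V (\<tau>1, \<tau>01) u \<and>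
        \<tau>1 = 0 \<and> form_support (V - M) \<tau>01 \<subseteq> tube W \<Phi> G)" (is "?L \<longleftrightarrow> ?R")
  proof
    assume ?R
    then obtain G V \<tau>01 where G: "closed_cone G" "G - {0} \<subseteq> {y. y \<bullet> \<xi>0 < 0}"
      and V: "open V" "x0 \<in> V" "V \<subseteq> W" and \<tau>01: "\<tau>01 \<in> forms A (?n - 1) (V - M)"
      and rep: "represents A M V (0, \<tau>01) u" and supp: "form_support (V - M) \<tau>01 \<subseteq> tube W \<Phi> G"
      unfolding half by blast
    let ?Q = "(V, tube W \<Phi> G)"
    have Q: "?Q \<in> ?J" by (rule microfunction_pairsI[OF V G])
    have fin: "finer (V, M) ?Q" using V(3) G(1) by (intro finer_tube) auto
    have "form_restrict (V - tube W \<Phi> G) \<tau>01 = 0"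
    proof
      fix x
      show "form_restrict (V - tube W \<Phi> G) \<tau>01 x = 0 x"
      proof (cases "x \<in> V - tube W \<Phi> G")
        case True
        then have "x \<in> V - M" using fin by (auto simp: finer_iff)
        moreover have "x \<notin> form_support (V - M) \<tau>01" using supp True by auto
        ultimately have "\<tau>01 x = 0"
          using closure_subset[of "{x \<in> V - M. \<tau>01 x \<noteq> 0}"] by (auto simp: form_support_def)
        then show ?thesis by (simp add: form_restrict_def)
      qed (auto simp: form_restrict_outside)
    qed
    then have "cochain_restrict ?Q (0, \<tau>01) = 0"
      by (simp add: cochain_restrict_def form_restrict_0 zero_prod_def)
    then have "cochain_restrict ?Q (0, \<tau>01) \<in> coboundaries A ?n ?Q"
      by (simp add: coboundaries_0)
    \<comment> \<open>Intersecting with the neighbourhood of the hyperfunction pair and keeping the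
      cone of the microfunction pair is enough.\<close>
    moreover have "\<exists>S\<in>?J. finer R S \<and> finer Q S" if RQ: "R \<in> ?I" "Q \<in> ?J" for R Q
    proof -
      obtain V1 where V1: "R = (V1, M)" "open V1" "x0 \<in> V1"
        using RQ(1) by (auto simp: hyperfunction_pairs_def)
      obtain V2 G2 where V2: "Q = (V2, tube W \<Phi> G2)" "open V2" "x0 \<in> V2" "V2 \<subseteq> W" "closed_cone G2"
        "G2 - {0} \<subseteq> {y. y \<bullet> \<xi>0 < 0}" using RQ(2) by (rule microfunction_pairsE)
      have "(V1 \<inter> V2, tube W \<Phi> G2) \<in> ?J" using V1 V2 by (intro microfunction_pairsI) auto
      moreover have "finer R (V1 \<inter> V2, tube W \<Phi> G2)" unfolding V1(1) using V2 by (intro finer_tube) auto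
      moreover have "finer Q (V1 \<inter> V2, tube W \<Phi> G2)" by (auto simp: V2(1) finer_iff)
      ultimately show ?thesis by blast
    qed
    ultimately have "dir_limit_map A ?n ?J u = dir_limit_zero A ?n ?J"
      using rep fin Q unfolding represents_def by (intro dir_limit_map_zeroI[OF I J _ u]) auto
    then show ?L by (simp add: microlocally_analytic_def spectral_map_def)
  next
    assume ?L
    then have zero: "dir_limit_map A ?n ?J u = dir_limit_zero A ?n ?J"
      by (simp add: microlocally_analytic_def spectral_map_def)
    obtain P0 \<sigma> where P0: "P0 \<in> ?I" "\<sigma> \<in> cocycles A ?n P0" "u = limit_rel A ?n ?I `` {(P0, cohom_class A ?n P0 \<sigma>)}"
      using dir_limit_representative[OF u] by blast
    obtain V0 where V0: "P0 = (V0, M)" "open V0" "x0 \<in> V0"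
      using P0(1) by (auto simp: hyperfunction_pairs_def)
    have "((P0, cohom_class A ?n P0 \<sigma>), (P0, cohom_class A ?n P0 \<sigma>)) \<in> limit_rel A ?n ?I"
      unfolding limit_rel_iff[OF I P0(1,2) P0(1,2)]
      using P0(1) by (intro bexI[of _ P0]) (simp_all add: finer_refl coboundaries_0)
    then have mem: "(P0, cohom_class A ?n P0 \<sigma>) \<in> u" unfolding P0(3) by simp
    have cone0: "closed_cone {0}" by (simp add: closed_cone_def cone_def)
    \<comment> \<open>The smallest cone is the weakest choice: its tube is M in W, so refining this
      pair restricts the neighbourhood to \<open>V0\<close> and imposes nothing on the cone
      G.\<close>
    have Q: "(V0 \<inter> W, tube W \<Phi> {0}) \<in> ?J"
      using V0 W cone0 by (intro microfunction_pairsI) auto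
    have "finer P0 (V0 \<inter> W, tube W \<Phi> {0})" unfolding V0(1) using cone0 by (intro finer_tube) auto
    then obtain R where R: "R \<in> ?J" "finer (V0 \<inter> W, tube W \<Phi> {0}) R" "cochain_restrict R \<sigma> \<in> coboundaries A ?n R"
      using dir_limit_map_zeroD[OF J zero mem P0(2) directed_pairs_open[OF I P0(1)] Q] by blast
    obtain V' G where V': "R = (V', tube W \<Phi> G)" "open V'" "x0 \<in> V'" "V' \<subseteq> W" "closed_cone G"
        "G - {0} \<subseteq> {y. y \<bullet> \<xi>0 < 0}" using R(1) by (rule microfunction_pairsE)
    obtain c where c: "c \<in> A" "x0 \<in> fst c" by (rule chart_cover)
    define V where "V = V' \<inter> fst c"
    have V: "open V" "x0 \<in> V" "V \<subseteq> W" "V \<subseteq> fst c" "V \<subseteq> V'" "V \<subseteq> V0"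
      using V' c open_chart[OF c(1)] R(2) unfolding V_def V'(1) finer_iff by auto
    let ?P = "(V, M)" and ?S = "(V, tube W \<Phi> G)"
    have PI: "?P \<in> ?I" using V by (auto simp: hyperfunction_pairs_def)
    have SJ: "?S \<in> ?J" by (rule microfunction_pairsI[OF V(1-3) V'(5,6)])
    have fin: "finer P0 ?P" "finer R ?S" "finer ?P ?S"
      using V V'(5) finer_tube by (auto simp: V0(1) V'(1) finer_iff)
    let ?\<sigma> = "cochain_restrict ?P \<sigma>"
    have \<sigma>: "?\<sigma> \<in> cocycles A ?n ?P"
      by (rule cocycles_restrict[OF fin(1) directed_pairs_open[OF I PI] P0(2)])
    have "cochain_restrict ?S ?\<sigma> \<in> coboundaries A ?n ?S"
      using coboundaries_restrict[OF fin(2) directed_pairs_open[OF J SJ] R(3)]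
      by (simp add: cochain_restrict_restrict fin)
    then obtain G' \<tau>01 where G': "closed_cone G'" "G' - {0} \<subseteq> {y. y \<bullet> \<xi>0 < 0}"
      and \<tau>: "(0, \<tau>01) \<in> cocycles A ?n ?P" "?\<sigma> - (0, \<tau>01) \<in> coboundaries A ?n ?P"
      and supp: "form_support (V - M) \<tau>01 \<subseteq> tube W \<Phi> G'"
      using representative_supported_in_tube[OF holomorphic_atlas_axioms W(1,3) M MW V(1,3,4) c(1) V'(5,6) \<sigma>]
      by blast
    \<comment> \<open>Forms are zero outside their domain, so restricting to that domain changes
      nothing, and \<open>?P\<close> itself can witness equality of the germs.\<close>
    have "cochain_restrict ?P (0, \<tau>01) = (0, \<tau>01)"
      using \<tau>(1) forms_outside[of \<tau>01 A "?n - 1" "V - M"]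
      by (auto simp: cocycles_def cochains_def cochain_restrict_def form_restrict_0) (auto simp: form_restrict_def)
    then have "((P0, cohom_class A ?n P0 \<sigma>), (?P, cohom_class A ?n ?P (0, \<tau>01))) \<in> limit_rel A ?n ?I"
      unfolding limit_rel_iff[OF I P0(1,2) PI \<tau>(1)] using PI fin(1) finer_refl \<tau>(2) by (intro bexI[of _ ?P]) auto
    then have "represents A M V (0, \<tau>01) u"
      unfolding represents_def P0(3) using \<tau>(1) by simp
    moreover have "\<tau>01 \<in> forms A (?n - 1) (V - M)" using \<tau>(1) by (auto simp: cocycles_def cochains_def)
    ultimately show ?R
      unfolding half using G' V supp forms_0
      by (intro exI[of _ G'] exI[of _ V] exI[of _ 0] exI[of _ \<tau>01]) simp
  qed
qed

end
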